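(* Let $n\ge 3$ be an integer, let $m>0$ be a real number, and let $(M^n,g)$ be a smooth, connected, complete, non-compact Riemannian manifold without boundary. Let $f,\lambda:M\to\mathbb{R}$ be smooth functions such that $$\mathrm{Ric}+\mathrm{Hess} f-\frac1m\, df\otimes df=\lambda g$$ on $M$, and assume that the scalar curvature $R$ of $g$ is constant. Set $v=e^{-f/m}\lambda$. Then, on $M$, $$e^{f/m}\Delta v=\frac{1}{n-1}\left(\frac{m-1}{m}\,|\hat{\mathrm{Ric}}|^2-\frac{R(n\lambda-R)}{n}\Bigl(1+\frac{n-1}{m}\Bigr)\right),$$ where $\hat{\mathrm{Ric}}=\mathrm{Ric}-\frac{R}{n}g$ is the trace-free Ricci tensor.
   Context: $\mathrm{Ric}$ is the Ricci tensor of $g$, $R$ its scalar curvature (the trace of $\mathrm{Ric}$), $\mathrm{Hess} f=\nabla df$ is the Hessian of $f$, $\Delta u=\mathrm{div}(\nabla u)$ is the Laplacian (trace of the Hessian), and $|\cdot|$ is the pointwise tensor norm induced by $g$. *)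

theory Defs
  imports "HOL-Analysis.Analysis"
begin

section \<open>Smooth maps between normed vector spaces\<close>

text \<open>Only meaningful for open \<open>S\<close>.\<close>

fun higher_differentiable_on ::
    "'a::real_normed_vector set \<Rightarrow> ('a \<Rightarrow> 'b::real_normed_vector) \<Rightarrow> nat \<Rightarrow> bool" where
  "higher_differentiable_on S h 0 \<longleftrightarrow> continuous_on S h"
| "higher_differentiable_on S h (Suc k) \<longleftrightarrow>
     (\<forall>x\<in>S. h differentiable (at x)) \<and>
     (\<forall>w. higher_differentiable_on S (\<lambda>x. frechet_derivative h (at x) w) k)"

definition smooth_on ::
    "'a::real_normed_vector set \<Rightarrow> ('a \<Rightarrow> 'b::real_normed_vector) \<Rightarrow> bool" where
  "smooth_on S h \<longleftrightarrow> (\<forall>k. higher_differentiable_on S h k)"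


section \<open>Smooth manifolds\<close>

text \<open>A chart is a pair of its domain and its coordinate map. The coordinate map is a total
  function, of which only the restriction to the domain is meaningful.\<close>

type_synonym ('a, 'n) chart = "'a set \<times> ('a \<Rightarrow> real^'n)"

abbreviation cdom :: "('a, 'n) chart \<Rightarrow> 'a set" where
  "cdom c \<equiv> fst c"

abbreviation coord :: "('a, 'n) chart \<Rightarrow> 'a \<Rightarrow> real^'n" where
  "coord c \<equiv> snd c"

definition inv_coord :: "('a, 'n) chart \<Rightarrow> real^'n \<Rightarrow> 'a" where
  "inv_coord c = inv_into (cdom c) (coord c)"

definition is_chart :: "'a topology \<Rightarrow> ('a, 'n::finite) chart \<Rightarrow> bool" where
  "is_chart M c \<longleftrightarrow>
     openin M (cdom c) \<and> open (coord c ` cdom c) \<and>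
     homeomorphic_map (subtopology M (cdom c)) (top_of_set (coord c ` cdom c)) (coord c)"

definition transition :: "('a, 'n) chart \<Rightarrow> ('a, 'n) chart \<Rightarrow> real^'n \<Rightarrow> real^'n" where
  "transition c d = coord d \<circ> inv_coord c"

text \<open>Manifolds without boundary, of dimension \<^term>\<open>CARD('n)\<close>. The atlas \<open>\<A>\<close> need not be
  maximal.\<close>

locale smooth_manifold =
  fixes M :: "'a topology" and \<A> :: "('a, 'n::finite) chart set"
  assumes Hausdorff: "Hausdorff_space M"
    and second_countable: "second_countable M"
    and charts: "\<And>c. c \<in> \<A> \<Longrightarrow> is_chart M c"
    and cover: "(\<Union>c\<in>\<A>. cdom c) = topspace M"
    and compatible: "\<And>c d. c \<in> \<A> \<Longrightarrow> d \<in> \<A> \<Longrightarrow>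
          smooth_on (coord c ` (cdom c \<inter> cdom d)) (transition c d)"

text \<open>\<open>u\<close> read in the chart \<open>c\<close> is \<open>u \<circ> inv_coord c\<close>.\<close>

definition smooth_in_chart :: "('a, 'n::finite) chart \<Rightarrow> ('a \<Rightarrow> 'b::real_normed_vector) \<Rightarrow> bool" where
  "smooth_in_chart c u \<longleftrightarrow> smooth_on (coord c ` cdom c) (u \<circ> inv_coord c)"

definition smooth_function :: "('a, 'n::finite) chart set \<Rightarrow> ('a \<Rightarrow> real) \<Rightarrow> bool" where
  "smooth_function \<A> u \<longleftrightarrow> (\<forall>c\<in>\<A>. smooth_in_chart c u)"

text \<open>The coordinate vector field \<open>\<partial>\<^sub>i\<close> of the chart \<open>c\<close>, applied to \<open>u\<close> at the point \<open>p\<close>.\<close>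

definition coord_deriv :: "('a, 'n::finite) chart \<Rightarrow> 'n \<Rightarrow> ('a \<Rightarrow> real) \<Rightarrow> 'a \<Rightarrow> real" where
  "coord_deriv c i u p = frechet_derivative (u \<circ> inv_coord c) (at (coord c p)) (axis i 1)"

text \<open>The Jacobian matrix \<open>(\<partial>y\<^sup>i/\<partial>x\<^sup>j)\<^sub>i\<^sub>j\<close> at \<open>p\<close>, with \<open>x\<close> the coordinates of \<open>c\<close> and \<open>y\<close>
  those of \<open>d\<close>.\<close>

definition jacobian_at :: "('a, 'n::finite) chart \<Rightarrow> ('a, 'n) chart \<Rightarrow> 'a \<Rightarrow> real^'n^'n" where
  "jacobian_at c d p = matrix (frechet_derivative (transition c d) (at (coord c p)))"


section \<open>Riemannian metrics\<close>

text \<open>A tensor field on the manifold is given by its components with respect to every chart: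
  a covariant 2-tensor field assigns to a chart \<open>c\<close> and a point \<open>p\<close> of its domain the matrix
  \<open>(T(\<partial>\<^sub>i, \<partial>\<^sub>j))\<^sub>i\<^sub>j\<close> at \<open>p\<close>, a vector field or a 1-form the column of its components.
  Assumption \<open>tensorial\<close> is the transformation law \<open>g\<^sub>i\<^sub>j = \<Sum>\<^sub>k\<^sub>l g'\<^sub>k\<^sub>l \<partial>y\<^sup>k/\<partial>x\<^sup>i \<partial>y\<^sup>l/\<partial>x\<^sup>j\<close>.\<close>

type_synonym ('a, 'n) tensor2 = "('a, 'n) chart \<Rightarrow> 'a \<Rightarrow> real^'n^'n"

locale riemannian_manifold = smooth_manifold M \<A>
  for M :: "'a topology" and \<A> :: "('a, 'n::finite) chart set" +
  fixes g :: "('a, 'n) tensor2"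
  assumes smooth_metric: "\<And>c i j. c \<in> \<A> \<Longrightarrow> smooth_in_chart c (\<lambda>p. g c p $ i $ j)"
    and symmetric: "\<And>c p. c \<in> \<A> \<Longrightarrow> p \<in> cdom c \<Longrightarrow> transpose (g c p) = g c p"
    and positive_definite:
      "\<And>c p w. c \<in> \<A> \<Longrightarrow> p \<in> cdom c \<Longrightarrow> w \<noteq> 0 \<Longrightarrow> w \<bullet> (g c p *v w) > 0"
    and tensorial: "\<And>c d p. c \<in> \<A> \<Longrightarrow> d \<in> \<A> \<Longrightarrow> p \<in> cdom c \<inter> cdom d \<Longrightarrow>
      g c p = transpose (jacobian_at c d p) ** g d p ** jacobian_at c d p"

text \<open>The trace \<open>G\<^sup>i\<^sup>j T\<^sub>i\<^sub>j\<close> and the norm \<open>|T|\<^sup>2 = G\<^sup>i\<^sup>k G\<^sup>j\<^sup>l T\<^sub>i\<^sub>j T\<^sub>k\<^sub>l\<close> of a covariant 2-tensor \<open>T\<close> at a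
  point, where \<open>G\<close> is the value of the metric at that point.\<close>

definition metric_trace :: "real^'n^'n \<Rightarrow> real^'n^'n \<Rightarrow> real" where
  "metric_trace G T = (\<Sum>i\<in>UNIV. \<Sum>j\<in>UNIV. matrix_inv G $ i $ j * T $ i $ j)"

definition tensor_norm :: "real^'n^'n \<Rightarrow> real^'n^'n \<Rightarrow> real" where
  "tensor_norm G T = sqrt (\<Sum>i\<in>UNIV. \<Sum>j\<in>UNIV. \<Sum>k\<in>UNIV. \<Sum>l\<in>UNIV.
      matrix_inv G $ i $ k * matrix_inv G $ j $ l * T $ i $ j * T $ k $ l)"

definition tensor_prod :: "real^'n \<Rightarrow> real^'n \<Rightarrow> real^'n^'n" where
  "tensor_prod \<alpha> \<beta> = (\<chi> i j. \<alpha> $ i * \<beta> $ j)"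


section \<open>The Levi-Civita connection and its geodesics\<close>

text \<open>\<open>christoffel g c k i j\<close> is \<open>\<Gamma>\<^sup>k\<^sub>i\<^sub>j\<close>, where \<open>\<nabla>\<^sub>\<partial>\<^sub>i \<partial>\<^sub>j = \<Gamma>\<^sup>k\<^sub>i\<^sub>j \<partial>\<^sub>k\<close>.\<close>

definition christoffel ::
    "('a, 'n::finite) tensor2 \<Rightarrow> ('a, 'n) chart \<Rightarrow> 'n \<Rightarrow> 'n \<Rightarrow> 'n \<Rightarrow> 'a \<Rightarrow> real" where
  "christoffel g c k i j p = 1/2 * (\<Sum>l\<in>UNIV. matrix_inv (g c p) $ k $ l *
      (coord_deriv c i (\<lambda>q. g c q $ j $ l) p
       + coord_deriv c j (\<lambda>q. g c q $ i $ l) p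
       - coord_deriv c l (\<lambda>q. g c q $ i $ j) p))"

text \<open>The entry \<open>(i, j)\<close> is \<open>(\<nabla>\<^sub>\<partial>\<^sub>i \<omega>)(\<partial>\<^sub>j)\<close>, respectively the \<open>j\<close>-th component of
  \<open>\<nabla>\<^sub>\<partial>\<^sub>i X\<close>.\<close>

definition cov_deriv_form ::
    "('a, 'n::finite) tensor2 \<Rightarrow> ('a, 'n) chart \<Rightarrow> ('a \<Rightarrow> real^'n) \<Rightarrow> 'a \<Rightarrow> real^'n^'n" where
  "cov_deriv_form g c \<omega> p = (\<chi> i j.
      coord_deriv c i (\<lambda>q. \<omega> q $ j) p - (\<Sum>k\<in>UNIV. christoffel g c k i j p * \<omega> p $ k))"

definition cov_deriv_field ::
    "('a, 'n::finite) tensor2 \<Rightarrow> ('a, 'n) chart \<Rightarrow> ('a \<Rightarrow> real^'n) \<Rightarrow> 'a \<Rightarrow> real^'n^'n" where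
  "cov_deriv_field g c X p = (\<chi> i j.
      coord_deriv c i (\<lambda>q. X q $ j) p + (\<Sum>k\<in>UNIV. christoffel g c j i k p * X p $ k))"

definition geodesic ::
    "'a topology \<Rightarrow> ('a, 'n::finite) chart set \<Rightarrow> ('a, 'n) tensor2 \<Rightarrow> (real \<Rightarrow> 'a) \<Rightarrow> bool" where
  "geodesic M \<A> g \<gamma> \<longleftrightarrow>
     continuous_map euclidean M \<gamma> \<and>
     (\<forall>c\<in>\<A>. \<forall>t. \<gamma> t \<in> cdom c \<longrightarrow>
        (let x = coord c \<circ> \<gamma>; x' = (\<lambda>s. vector_derivative x (at s)) in
         x differentiable (at t) \<and> x' differentiable (at t) \<and>
         (\<forall>k. vector_derivative x' (at t) $ k
               + (\<Sum>i\<in>UNIV. \<Sum>j\<in>UNIV. christoffel g c k i j (\<gamma> t) * x' t $ i * x' t $ j) = 0)))"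

text \<open>Completeness: every tangent vector is the initial velocity of a geodesic that is defined on
  the whole real line.\<close>

definition geodesically_complete ::
    "'a topology \<Rightarrow> ('a, 'n::finite) chart set \<Rightarrow> ('a, 'n) tensor2 \<Rightarrow> bool" where
  "geodesically_complete M \<A> g \<longleftrightarrow>
     (\<forall>c\<in>\<A>. \<forall>p\<in>cdom c. \<forall>w :: real^'n. \<exists>\<gamma>. geodesic M \<A> g \<gamma> \<and>
        \<gamma> 0 = p \<and> vector_derivative (coord c \<circ> \<gamma>) (at 0) = w)"


section \<open>Hessian and Laplacian\<close>

definition differential :: "('a, 'n::finite) chart \<Rightarrow> ('a \<Rightarrow> real) \<Rightarrow> 'a \<Rightarrow> real^'n" where
  "differential c u p = (\<chi> i. coord_deriv c i u p)"

definition gradient ::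
    "('a, 'n::finite) tensor2 \<Rightarrow> ('a, 'n) chart \<Rightarrow> ('a \<Rightarrow> real) \<Rightarrow> 'a \<Rightarrow> real^'n" where
  "gradient g c u p = matrix_inv (g c p) *v differential c u p"

definition hessian ::
    "('a, 'n::finite) tensor2 \<Rightarrow> ('a, 'n) chart \<Rightarrow> ('a \<Rightarrow> real) \<Rightarrow> 'a \<Rightarrow> real^'n^'n" where
  "hessian g c u = cov_deriv_form g c (differential c u)"

definition divergence ::
    "('a, 'n::finite) tensor2 \<Rightarrow> ('a, 'n) chart \<Rightarrow> ('a \<Rightarrow> real^'n) \<Rightarrow> 'a \<Rightarrow> real" where
  "divergence g c X p = trace (cov_deriv_field g c X p)"

definition laplacian ::
    "('a, 'n::finite) tensor2 \<Rightarrow> ('a, 'n) chart \<Rightarrow> ('a \<Rightarrow> real) \<Rightarrow> 'a \<Rightarrow> real" where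
  "laplacian g c u = divergence g c (gradient g c u)"


section \<open>Curvature\<close>

text \<open>\<open>riemann g c l i j k\<close> is the \<open>l\<close>-th component of \<open>R(\<partial>\<^sub>i, \<partial>\<^sub>j)\<partial>\<^sub>k\<close>, where
  \<open>R(X, Y)Z = \<nabla>\<^sub>X \<nabla>\<^sub>Y Z - \<nabla>\<^sub>Y \<nabla>\<^sub>X Z - \<nabla>\<^sub>[\<^sub>X\<^sub>,\<^sub>Y\<^sub>] Z\<close>, and \<open>Ric(Y, Z)\<close> is the trace of
  \<open>X \<mapsto> R(X, Y)Z\<close>. With these signs round spheres have positive Ricci curvature.\<close>

definition riemann ::
    "('a, 'n::finite) tensor2 \<Rightarrow> ('a, 'n) chart \<Rightarrow> 'n \<Rightarrow> 'n \<Rightarrow> 'n \<Rightarrow> 'n \<Rightarrow> 'a \<Rightarrow> real" where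
  "riemann g c l i j k p =
     coord_deriv c i (christoffel g c l j k) p - coord_deriv c j (christoffel g c l i k) p
     + (\<Sum>r\<in>UNIV. christoffel g c l i r p * christoffel g c r j k p
                 - christoffel g c l j r p * christoffel g c r i k p)"

definition ricci :: "('a, 'n::finite) tensor2 \<Rightarrow> ('a, 'n) tensor2" where
  "ricci g c p = (\<chi> j k. \<Sum>i\<in>UNIV. riemann g c i i j k p)"

definition scalar_curvature ::
    "('a, 'n::finite) tensor2 \<Rightarrow> ('a, 'n) chart \<Rightarrow> 'a \<Rightarrow> real" where
  "scalar_curvature g c p = metric_trace (g c p) (ricci g c p)"

definition traceless_ricci :: "('a, 'n::finite) tensor2 \<Rightarrow> ('a, 'n) tensor2" where
  "traceless_ricci g c p =
     ricci g c p - (scalar_curvature g c p / real CARD('n)) *\<^sub>R g c p"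

end

theory Submission
  imports Defs
begin

text \<open>Put \<open>u = e\<^bsup>-f/m\<^esup>\<close>. The quasi-Einstein equation becomes \<open>Hess u = u/m (Ric - \<lambda> g)\<close>, hence
  \<open>\<Delta>u = u/m (R - n\<lambda>)\<close>. Inserting both into \<open>div (Hess u) = d \<Delta>u + Ric(\<nabla>u)\<close>, with \<open>div Ric = dR/2 = 0\<close> by the
  contracted Bianchi identity, gives \<open>(n-1) dv = R du + (m-1) Ric(\<nabla>u)\<close> for \<open>v = u\<lambda>\<close>. The divergence
  of this equation is \<open>(n-1) \<Delta>v = R \<Delta>u + (m-1) \<langle>Ric, Hess u\<rangle>\<close>, which is the claim. All of this is done in
  the coordinates of a single chart.\<close>

subsection \<open>Calculus of smooth functions\<close>

text \<open>The exponential is dictated by the quadratic term: Hess u = -u/m (Hess f - df (x) df /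
  m), so passing to u makes the equation linear in u, and lambda then occurs in it only through v =
  u lambda. Evaluating div (Hess u) directly gives (Ric(grad u) - dv)/m, while commuting derivatives
  gives (R du - n dv)/m + Ric(grad u); equating the two isolates dv. Constancy of R both turns d(u
  R) into R du and removes div Ric, here and again in the second divergence. Inserting Hess u once
  more produces |Ric|^2, and splitting off the trace, |Ric|^2 = |trace-free Ric|^2 + R^2/n, yields
  the stated form. Most of the work lies in deriving the curvature symmetries, the Bianchi
  identities and the commutation rule from the coordinate definition of the Christoffel symbols.
  Tensors are handled as families of functions of indices, and parallelism of the metric is
  exploited mainly through \<open>D_contr\<close>: the derivative of a contraction is the
  contraction of the covariant derivative.\<close>

lemma has_derivative_cong_open:
  assumes "open S" "x \<in> S" "\<And>y. y \<in> S \<Longrightarrow> h y = k y"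
  shows "(h has_derivative D) (at x) \<longleftrightarrow> (k has_derivative D) (at x)"
  using assms by (metis has_derivative_transform_within_open)

lemma frechet_derivative_cong_open:
  assumes "open S" "x \<in> S" "\<And>y. y \<in> S \<Longrightarrow> h y = k y"
  shows "frechet_derivative h (at x) = frechet_derivative k (at x)"
  unfolding frechet_derivative_def using has_derivative_cong_open[OF assms] by presburger

lemma differentiable_cong_open:
  assumes "open S" "x \<in> S" "\<And>y. y \<in> S \<Longrightarrow> h y = k y"
  shows "h differentiable (at x) \<longleftrightarrow> k differentiable (at x)"
  unfolding differentiable_def using has_derivative_cong_open[OF assms] by presburger

lemma higher_differentiable_on_cong:
  assumes "open S" "\<And>x. x \<in> S \<Longrightarrow> h x = k x"
  shows "higher_differentiable_on S h n \<longleftrightarrow> higher_differentiable_on S k n"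
  using assms(2)
proof (induction n arbitrary: h k)
  case 0
  then show ?case by (simp cong: continuous_on_cong)
next
  case (Suc n)
  have "frechet_derivative h (at x) w = frechet_derivative k (at x) w" if "x \<in> S" for x w
    using frechet_derivative_cong_open[OF assms(1) that Suc.prems] by simp
  then have "higher_differentiable_on S (\<lambda>x. frechet_derivative h (at x) w) n \<longleftrightarrow>
      higher_differentiable_on S (\<lambda>x. frechet_derivative k (at x) w) n" for w
    by (rule Suc.IH)
  moreover have "(\<forall>x\<in>S. h differentiable (at x)) \<longleftrightarrow> (\<forall>x\<in>S. k differentiable (at x))"
    using differentiable_cong_open[OF assms(1), where h = h and k = k] Suc.prems by blast
  ultimately show ?case by simp
qed

lemma higher_differentiable_on_SucD:
  "higher_differentiable_on S h (Suc n) \<Longrightarrow> higher_differentiable_on S h n"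
proof (induction n arbitrary: h)
  case 0
  then show ?case
    by (auto intro!: continuous_at_imp_continuous_on differentiable_imp_continuous_within)
next
  case (Suc n)
  then show ?case by (metis higher_differentiable_on.simps(2))
qed

lemma frechet_derivative_mult_real:
  fixes h k :: "'a::real_normed_vector \<Rightarrow> real"
  assumes "h differentiable (at x)" "k differentiable (at x)"
  shows "frechet_derivative (\<lambda>y. h y * k y) (at x) w =
    h x * frechet_derivative k (at x) w + frechet_derivative h (at x) w * k x"
  using has_derivative_mult[OF assms[unfolded frechet_derivative_works]]
  by (simp add: frechet_derivative_at[symmetric])

lemma frechet_derivative_add:
  assumes "h differentiable (at x)" "k differentiable (at x)"
  shows "frechet_derivative (\<lambda>y. h y + k y) (at x) w =
    frechet_derivative h (at x) w + frechet_derivative k (at x) w"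
  using has_derivative_add[OF assms[unfolded frechet_derivative_works]]
  by (simp add: frechet_derivative_at[symmetric])

text \<open>Written with \<open>- 1 *\<close> and a product instead of a quotient, so that closure
  under products and constants applies to the derivative as it stands.\<close>

lemma frechet_derivative_inverse_real:
  fixes h :: "'a::real_normed_vector \<Rightarrow> real"
  assumes "h differentiable (at x)" "h x \<noteq> 0"
  shows "frechet_derivative (\<lambda>y. inverse (h y)) (at x) w =
    - 1 * (frechet_derivative h (at x) w * (inverse (h x) * inverse (h x)))"
  using Deriv.has_derivative_inverse[OF assms(2) assms(1)[unfolded frechet_derivative_works]]
  by (simp add: frechet_derivative_at[symmetric])

lemma frechet_derivative_exp_real:
  fixes h :: "'a::real_normed_vector \<Rightarrow> real"
  assumes "h differentiable (at x)"
  shows "frechet_derivative (\<lambda>y. exp (h y)) (at x) w =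
    exp (h x) * frechet_derivative h (at x) w"
proof -
  have "((\<lambda>y. exp (h y)) has_derivative
      (\<lambda>w. exp (h x) * frechet_derivative h (at x) w)) (at x)"
    using has_derivative_exp[OF assms[unfolded frechet_derivative_works]] by (simp add: mult.commute)
  then show ?thesis by (simp add: frechet_derivative_at[symmetric])
qed

lemma higher_differentiable_on_const: "higher_differentiable_on S (\<lambda>_. a) n"
  by (induction n arbitrary: a) simp_all

lemma higher_differentiable_on_add:
  assumes "open S" "higher_differentiable_on S h n" "higher_differentiable_on S k n"
  shows "higher_differentiable_on S (\<lambda>x. h x + k x) n"
  using assms(2,3)
proof (induction n arbitrary: h k)
  case 0
  then show ?case by (auto intro: continuous_intros)
next
  case (Suc n)
  have "higher_differentiable_on S (\<lambda>x. frechet_derivative (\<lambda>y. h y + k y) (at x) w) n" for w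
    using Suc by (subst higher_differentiable_on_cong[OF assms(1) frechet_derivative_add]) auto
  with Suc.prems show ?case by auto
qed

lemma higher_differentiable_on_mult:
  fixes h k :: "'a::real_normed_vector \<Rightarrow> real"
  assumes "open S" "higher_differentiable_on S h n" "higher_differentiable_on S k n"
  shows "higher_differentiable_on S (\<lambda>x. h x * k x) n"
  using assms(2,3)
proof (induction n arbitrary: h k)
  case 0
  then show ?case by (auto intro: continuous_intros)
next
  case (Suc n)
  have "higher_differentiable_on S (\<lambda>x. frechet_derivative (\<lambda>y. h y * k y) (at x) w) n" for w
    \<comment> \<open>Each term of the product rule keeps one factor undifferentiated, whose order
      must be lowered to that of the other factor.\<close>
    using Suc higher_differentiable_on_SucD[OF Suc.prems(1)] higher_differentiable_on_SucD[OF Suc.prems(2)]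
    by (subst higher_differentiable_on_cong[OF assms(1) frechet_derivative_mult_real])
      (auto intro!: higher_differentiable_on_add[OF assms(1)])
  with Suc.prems show ?case by auto
qed

lemma higher_differentiable_on_inverse:
  fixes h :: "'a::real_normed_vector \<Rightarrow> real"
  assumes "open S" "higher_differentiable_on S h n" "\<And>x. x \<in> S \<Longrightarrow> h x \<noteq> 0"
  shows "higher_differentiable_on S (\<lambda>x. inverse (h x)) n"
  using assms(2,3)
proof (induction n arbitrary: h)
  case 0
  then show ?case by (auto intro: continuous_intros)
next
  case (Suc n)
  \<comment> \<open>The derivative contains \<open>inverse (h x)\<close> again, so the induction
    hypothesis is needed for the same \<open>h\<close> at the lower order.\<close>
  have "higher_differentiable_on S (\<lambda>x. inverse (h x)) n"
    using Suc.IH Suc.prems higher_differentiable_on_SucD by blast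
  then have "higher_differentiable_on S
      (\<lambda>x. - 1 * (frechet_derivative h (at x) w * (inverse (h x) * inverse (h x)))) n" for w
    using Suc.prems(1)
    by (intro higher_differentiable_on_mult[OF assms(1)] higher_differentiable_on_const) auto
  then have "higher_differentiable_on S (\<lambda>x. frechet_derivative (\<lambda>y. inverse (h y)) (at x) w) n" for w
    using Suc.prems
    by (subst higher_differentiable_on_cong[OF assms(1) frechet_derivative_inverse_real]) simp_all
  with Suc.prems show ?case by auto
qed

lemma higher_differentiable_on_exp:
  fixes h :: "'a::real_normed_vector \<Rightarrow> real"
  assumes "open S" "higher_differentiable_on S h n"
  shows "higher_differentiable_on S (\<lambda>x. exp (h x)) n"
  using assms(2)
proof (induction n arbitrary: h)
  case 0
  then show ?case by (auto intro: continuous_intros)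
next
  case (Suc n)
  have "higher_differentiable_on S (\<lambda>x. exp (h x)) n"
    using Suc.IH Suc.prems higher_differentiable_on_SucD by blast
  then have "higher_differentiable_on S (\<lambda>x. frechet_derivative (\<lambda>y. exp (h y)) (at x) w) n" for w
    using Suc.prems
    by (subst higher_differentiable_on_cong[OF assms(1) frechet_derivative_exp_real])
      (auto intro!: higher_differentiable_on_mult[OF assms(1)])
  moreover have "(\<lambda>y. exp (h y)) differentiable (at x)" if "x \<in> S" for x
  proof -
    have "h differentiable (at x)" using Suc.prems that by simp
    then show ?thesis unfolding differentiable_def by (auto dest: has_derivative_exp)
  qed
  ultimately show ?case by simp
qed

section \<open>Symmetry of second derivatives\<close>

text \<open>The mean value theorem is used twice: on the increment \<open>\<phi>\<close> of
  \<open>h\<close> across \<open>t *\<^sub>R w\<close>, moving along \<open>v\<close>, and then on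
  the derivative \<open>hv\<close>, moving along \<open>w\<close>. The left side of the conclusion
  is symmetric in \<open>v\<close> and \<open>w\<close>, the right side is not.\<close>

lemma second_difference_mean_value:
  fixes h :: "'a::real_normed_vector \<Rightarrow> real"
  assumes diff: "\<And>y. y \<in> S \<Longrightarrow> h differentiable (at y)"
    and diff2: "\<And>y. y \<in> S \<Longrightarrow> (\<lambda>z. frechet_derivative h (at z) v) differentiable (at y)"
    and mem: "\<And>a b. 0 \<le> a \<Longrightarrow> a \<le> t \<Longrightarrow> 0 \<le> b \<Longrightarrow> b \<le> t \<Longrightarrow> x + a *\<^sub>R v + b *\<^sub>R w \<in> S"
    and t: "t > 0"
  obtains a b where "0 \<le> a" "a \<le> t" "0 \<le> b" "b \<le> t"
    "h (x + t *\<^sub>R v + t *\<^sub>R w) - h (x + t *\<^sub>R v) - h (x + t *\<^sub>R w) + h x =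
      t * t * frechet_derivative (\<lambda>z. frechet_derivative h (at z) v)
        (at (x + a *\<^sub>R v + b *\<^sub>R w)) w"
proof -
  define hv where "hv = (\<lambda>z. frechet_derivative h (at z) v)"
  define \<phi> where "\<phi> = (\<lambda>a. h (x + a *\<^sub>R v + t *\<^sub>R w) - h (x + a *\<^sub>R v))"
  have line: "((\<lambda>a. k (y + a *\<^sub>R u)) has_field_derivative frechet_derivative k (at (y + a *\<^sub>R u)) u) (at a)"
    if "k differentiable (at (y + a *\<^sub>R u))" for k :: "'a \<Rightarrow> real" and y u a
  proof -
    have k: "(k has_derivative frechet_derivative k (at (y + a *\<^sub>R u))) (at (y + a *\<^sub>R u))"
      using that frechet_derivative_works by blast
    have "((\<lambda>a. y + a *\<^sub>R u) has_derivative (\<lambda>s. s *\<^sub>R u)) (at a)"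
      by (auto intro!: derivative_eq_intros)
    then have "((\<lambda>a. k (y + a *\<^sub>R u)) has_derivative
        (\<lambda>s. frechet_derivative k (at (y + a *\<^sub>R u)) (s *\<^sub>R u))) (at a)"
      using has_derivative_compose k by blast
    moreover have "linear (frechet_derivative k (at (y + a *\<^sub>R u)))"
      using that by (rule linear_frechet_derivative)
    ultimately show ?thesis
      by (simp add: has_field_derivative_def linear_scale mult_commute_abs)
  qed
  have "\<exists>a>0. a < t \<and> \<phi> t - \<phi> 0 = (t - 0) * (hv (x + a *\<^sub>R v + t *\<^sub>R w) - hv (x + a *\<^sub>R v))"
  proof (rule MVT2[OF t])
    fix a assume a: "0 \<le> a" "a \<le> t"
    have "x + a *\<^sub>R v + 0 *\<^sub>R w \<in> S" "(x + a *\<^sub>R v + t *\<^sub>R w) \<in> S"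
      using mem a t by (meson order_refl less_imp_le)+
    then have "h differentiable (at (x + a *\<^sub>R v))" "h differentiable (at (x + t *\<^sub>R w + a *\<^sub>R v))"
      using diff by (auto simp: algebra_simps)
    from line[OF this(1)] line[OF this(2)]
    show "(\<phi> has_field_derivative hv (x + a *\<^sub>R v + t *\<^sub>R w) - hv (x + a *\<^sub>R v)) (at a)"
      unfolding \<phi>_def hv_def by (auto intro!: derivative_intros simp: algebra_simps)
  qed
  then obtain a where a: "0 < a" "a < t"
    and 1: "\<phi> t - \<phi> 0 = t * (hv (x + a *\<^sub>R v + t *\<^sub>R w) - hv (x + a *\<^sub>R v))" by auto
  have "\<exists>b>0. b < t \<and> hv (x + a *\<^sub>R v + t *\<^sub>R w) - hv (x + a *\<^sub>R v + 0 *\<^sub>R w) =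
      (t - 0) * frechet_derivative hv (at (x + a *\<^sub>R v + b *\<^sub>R w)) w"
  proof (rule MVT2[OF t])
    fix b assume b: "0 \<le> b" "b \<le> t"
    have "x + a *\<^sub>R v + b *\<^sub>R w \<in> S" using mem a b by simp
    then show "((\<lambda>b. hv (x + a *\<^sub>R v + b *\<^sub>R w)) has_field_derivative
        frechet_derivative hv (at (x + a *\<^sub>R v + b *\<^sub>R w)) w) (at b)"
      using diff2 unfolding hv_def by (intro line) auto
  qed
  then obtain b where b: "0 < b" "b < t"
    and 2: "hv (x + a *\<^sub>R v + t *\<^sub>R w) - hv (x + a *\<^sub>R v) =
      t * frechet_derivative hv (at (x + a *\<^sub>R v + b *\<^sub>R w)) w" by auto
  show ?thesis
    using a b 1 2 by (intro that[of a b]) (auto simp: \<phi>_def hv_def)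
qed

text \<open>The symmetric second difference equals each mixed derivative at some point of a small
  parallelogram at \<open>x\<close>; continuity of both mixed derivatives carries the equality over
  to \<open>x\<close>.\<close>

lemma frechet_derivative_commute:
  fixes h :: "'a::real_normed_vector \<Rightarrow> real"
  assumes S: "open S" "x \<in> S" and h: "higher_differentiable_on S h 2"
  shows "frechet_derivative (\<lambda>y. frechet_derivative h (at y) v) (at x) w =
    frechet_derivative (\<lambda>y. frechet_derivative h (at y) w) (at x) v"
proof (rule ccontr)
  let ?D = "\<lambda>v w y. frechet_derivative (\<lambda>y. frechet_derivative h (at y) v) (at y) w"
  assume "?D v w x \<noteq> ?D w v x"
  \<comment> \<open>Half the gap, so that two errors below \<open>e\<close> cannot bridge
    it.\<close>
  define e where "e = \<bar>?D v w x - ?D w v x\<bar> / 2"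
  have e: "e > 0" using \<open>?D v w x \<noteq> ?D w v x\<close> by (simp add: e_def)
  have h': "higher_differentiable_on S h (Suc (Suc 0))" using h by (simp add: numeral_2_eq_2)
  have diff: "h differentiable (at y)" if "y \<in> S" for y using h' that by simp
  have diff2: "(\<lambda>z. frechet_derivative h (at z) u) differentiable (at y)" if "y \<in> S" for u y
    using h' that by simp
  have cont: "isCont (?D u u') x" for u u'
    using h' S by (simp add: continuous_on_eq_continuous_at)
  have "\<exists>d>0. \<forall>y. dist y x < d \<longrightarrow> dist (?D u u' y) (?D u u' x) < e" for u u'
    using cont[of u u'] e unfolding continuous_at_eps_delta by blast
  then obtain d1 d2 where d1: "d1 > 0" "\<And>y. dist y x < d1 \<Longrightarrow> dist (?D v w y) (?D v w x) < e"
    and d2: "d2 > 0" "\<And>y. dist y x < d2 \<Longrightarrow> dist (?D w v y) (?D w v x) < e"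
    by metis
  obtain d0 where d0: "d0 > 0" "ball x d0 \<subseteq> S" using S open_contains_ball by blast
  define d where "d = min d0 (min d1 d2)"
  have d: "d > 0" using d0 d1 d2 by (simp add: d_def)
  \<comment> \<open>Small enough for the whole parallelogram to lie in the ball of radius
    \<open>d\<close>; the summand 1 keeps the quotient meaningful when both vectors vanish.\<close>
  define t where "t = d / (norm v + norm w + 1)"
  have nz: "norm v + norm w + 1 > 0" by (simp add: add_nonneg_pos)
  have t: "t > 0" using d nz by (simp add: t_def)
  have near: "dist (x + a *\<^sub>R v + b *\<^sub>R w) x < d" if "0 \<le> a" "a \<le> t" "0 \<le> b" "b \<le> t" for a b
  proof -
    have "dist (x + a *\<^sub>R v + b *\<^sub>R w) x \<le> a * norm v + b * norm w"
      using that norm_triangle_ineq[of "a *\<^sub>R v" "b *\<^sub>R w"] by (simp add: dist_norm algebra_simps)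
    also have "\<dots> \<le> t * norm v + t * norm w"
      using that by (intro add_mono mult_right_mono) auto
    also have "\<dots> < t * (norm v + norm w + 1)" using t by (simp add: algebra_simps)
    also have "\<dots> = d" using nz by (simp add: t_def)
    finally show ?thesis .
  qed
  have inS: "x + a *\<^sub>R v + b *\<^sub>R w \<in> S" if "0 \<le> a" "a \<le> t" "0 \<le> b" "b \<le> t" for a b
    using near[OF that] d0 by (auto simp: d_def subset_iff dist_commute)
  have inS': "x + a *\<^sub>R w + b *\<^sub>R v \<in> S" if "0 \<le> a" "a \<le> t" "0 \<le> b" "b \<le> t" for a b
    using inS[OF that(3,4,1,2)] by (simp add: algebra_simps)
  obtain a b where ab: "0 \<le> a" "a \<le> t" "0 \<le> b" "b \<le> t" and
    1: "h (x + t *\<^sub>R v + t *\<^sub>R w) - h (x + t *\<^sub>R v) - h (x + t *\<^sub>R w) + h x =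
      t * t * ?D v w (x + a *\<^sub>R v + b *\<^sub>R w)"
    by (rule second_difference_mean_value[OF diff diff2 inS t])
  obtain a' b' where ab': "0 \<le> a'" "a' \<le> t" "0 \<le> b'" "b' \<le> t" and
    2: "h (x + t *\<^sub>R w + t *\<^sub>R v) - h (x + t *\<^sub>R w) - h (x + t *\<^sub>R v) + h x =
      t * t * ?D w v (x + a' *\<^sub>R w + b' *\<^sub>R v)"
    by (rule second_difference_mean_value[OF diff diff2 inS' t])
  have "x + t *\<^sub>R w + t *\<^sub>R v = x + t *\<^sub>R v + t *\<^sub>R w" by (simp add: algebra_simps)
  with 1 2 have "t * t * ?D v w (x + a *\<^sub>R v + b *\<^sub>R w) =
      t * t * ?D w v (x + a' *\<^sub>R w + b' *\<^sub>R v)"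
    by (simp add: algebra_simps)
  with t have eq: "?D v w (x + a *\<^sub>R v + b *\<^sub>R w) = ?D w v (x + a' *\<^sub>R w + b' *\<^sub>R v)"
    by simp
  have "x + a' *\<^sub>R w + b' *\<^sub>R v = x + b' *\<^sub>R v + a' *\<^sub>R w" by (simp add: algebra_simps)
  then have "dist (x + a' *\<^sub>R w + b' *\<^sub>R v) x < d" using near ab' by metis
  then have "dist (?D w v (x + a' *\<^sub>R w + b' *\<^sub>R v)) (?D w v x) < e"
    by (intro d2) (simp add: d_def)
  moreover have "dist (?D v w x) (?D v w (x + a *\<^sub>R v + b *\<^sub>R w)) < e"
    using d1(2)[of "x + a *\<^sub>R v + b *\<^sub>R w"] near[OF ab] by (simp add: d_def dist_commute)
  moreover have "dist (?D v w x) (?D w v x) \<le> dist (?D v w x) (?D v w (x + a *\<^sub>R v + b *\<^sub>R w)) +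
      dist (?D w v (x + a' *\<^sub>R w + b' *\<^sub>R v)) (?D w v x)"
    unfolding eq by (rule dist_triangle)
  ultimately have "dist (?D v w x) (?D w v x) < e + e" by linarith
  then show False by (simp add: e_def dist_real_def)
qed

subsection \<open>Coordinate derivatives\<close>

locale manifold_chart = smooth_manifold M \<A>
  for M :: "'a topology" and \<A> :: "('a, 'n::finite) chart set" +
  fixes c :: "('a, 'n) chart"
  assumes chart_mem: "c \<in> \<A>"
begin

abbreviation smooth :: "('a \<Rightarrow> real) \<Rightarrow> bool" where
  "smooth \<equiv> smooth_in_chart c"

abbreviation D :: "'n \<Rightarrow> ('a \<Rightarrow> real) \<Rightarrow> 'a \<Rightarrow> real" where
  "D \<equiv> coord_deriv c"

lemma open_image: "open (coord c ` cdom c)"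
  using charts[OF chart_mem] by (simp add: is_chart_def)

lemma inj_on_coord: "inj_on (coord c) (cdom c)"
proof -
  have "openin M (cdom c)"
    and "homeomorphic_map (subtopology M (cdom c)) (top_of_set (coord c ` cdom c)) (coord c)"
    using charts[OF chart_mem] by (simp_all add: is_chart_def)
  then show ?thesis
    using homeomorphic_imp_injective_map openin_subset topspace_subtopology_subset by fastforce
qed

lemma inv_coord_coord [simp]: "p \<in> cdom c \<Longrightarrow> inv_coord c (coord c p) = p"
  by (simp add: inv_coord_def inv_into_f_f inj_on_coord)

lemma smooth_cong:
  assumes "\<And>q. q \<in> cdom c \<Longrightarrow> u q = w q"
  shows "smooth u \<longleftrightarrow> smooth w"
proof -
  have "higher_differentiable_on (coord c ` cdom c) (u \<circ> inv_coord c) k \<longleftrightarrow>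
      higher_differentiable_on (coord c ` cdom c) (w \<circ> inv_coord c) k" for k
    using assms by (intro higher_differentiable_on_cong open_image) auto
  then show ?thesis by (simp add: smooth_in_chart_def smooth_on_def)
qed

text \<open>Identities such as the symmetry of the metric hold only on the chart domain. As its
  image is open, they may be differentiated all the same.\<close>

lemma D_cong:
  assumes "p \<in> cdom c" "\<And>q. q \<in> cdom c \<Longrightarrow> u q = w q"
  shows "D i u p = D i w p"
proof -
  have "frechet_derivative (u \<circ> inv_coord c) (at (coord c p)) =
      frechet_derivative (w \<circ> inv_coord c) (at (coord c p))"
    using assms by (intro frechet_derivative_cong_open[OF open_image]) auto
  then show ?thesis by (simp add: coord_deriv_def)
qed

lemma smooth_const [intro]: "smooth (\<lambda>q. a)"
  by (simp add: smooth_in_chart_def smooth_on_def comp_def higher_differentiable_on_const)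

lemma smooth_add [intro]: "smooth u \<Longrightarrow> smooth w \<Longrightarrow> smooth (\<lambda>q. u q + w q)"
  by (simp add: smooth_in_chart_def smooth_on_def comp_def higher_differentiable_on_add open_image)

lemma smooth_mult [intro]: "smooth u \<Longrightarrow> smooth w \<Longrightarrow> smooth (\<lambda>q. u q * w q)"
  by (simp add: smooth_in_chart_def smooth_on_def comp_def higher_differentiable_on_mult open_image)

lemma smooth_minus [intro]: "smooth u \<Longrightarrow> smooth (\<lambda>q. - u q)"
  using smooth_mult[OF smooth_const[of "- 1"], of u] by simp

lemma smooth_diff [intro]: "smooth u \<Longrightarrow> smooth w \<Longrightarrow> smooth (\<lambda>q. u q - w q)"
  using smooth_add[OF _ smooth_minus, of u w] by simp

lemma smooth_sum [intro]: "(\<And>i. i \<in> I \<Longrightarrow> smooth (u i)) \<Longrightarrow> smooth (\<lambda>q. \<Sum>i\<in>I. u i q)"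
  by (induction I rule: infinite_finite_induct) auto

lemma smooth_prod [intro]: "(\<And>i. i \<in> I \<Longrightarrow> smooth (u i)) \<Longrightarrow> smooth (\<lambda>q. \<Prod>i\<in>I. u i q)"
  by (induction I rule: infinite_finite_induct) auto

lemma smooth_inverse:
  "smooth u \<Longrightarrow> (\<And>q. q \<in> cdom c \<Longrightarrow> u q \<noteq> 0) \<Longrightarrow> smooth (\<lambda>q. inverse (u q))"
  unfolding smooth_in_chart_def smooth_on_def comp_def
  by (auto intro!: higher_differentiable_on_inverse open_image)

lemma smooth_exp [intro]: "smooth u \<Longrightarrow> smooth (\<lambda>q. exp (u q))"
  by (simp add: smooth_in_chart_def smooth_on_def comp_def higher_differentiable_on_exp open_image)

lemma coord_deriv_inv_coord:
  assumes "y \<in> coord c ` cdom c"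
  shows "D i u (inv_coord c y) = frechet_derivative (u \<circ> inv_coord c) (at y) (axis i 1)"
  using assms by (auto simp: coord_deriv_def)

lemma smooth_D [intro]:
  assumes "smooth u"
  shows "smooth (D i u)"
  unfolding smooth_in_chart_def smooth_on_def
proof
  fix k
  have "higher_differentiable_on (coord c ` cdom c) (u \<circ> inv_coord c) (Suc k)"
    using assms by (auto simp: smooth_in_chart_def smooth_on_def simp del: higher_differentiable_on.simps)
  then show "higher_differentiable_on (coord c ` cdom c) (D i u \<circ> inv_coord c) k"
    by (subst higher_differentiable_on_cong[OF open_image,
          where k = "\<lambda>y. frechet_derivative (u \<circ> inv_coord c) (at y) (axis i 1)"])
      (simp_all add: coord_deriv_inv_coord)
qed

lemma smooth_differentiable:
  assumes "smooth u" "p \<in> cdom c"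
  shows "(\<lambda>y. u (inv_coord c y)) differentiable (at (coord c p))"
proof -
  have "higher_differentiable_on (coord c ` cdom c) (u \<circ> inv_coord c) (Suc 0)"
    using assms by (auto simp: smooth_in_chart_def smooth_on_def simp del: higher_differentiable_on.simps)
  with assms(2) show ?thesis by (auto simp: comp_def)
qed

lemma D_const [simp]: "D i (\<lambda>q. a) p = 0"
  by (simp add: coord_deriv_def comp_def)

lemma D_add:
  "smooth u \<Longrightarrow> smooth w \<Longrightarrow> p \<in> cdom c \<Longrightarrow> D i (\<lambda>q. u q + w q) p = D i u p + D i w p"
  by (simp add: coord_deriv_def comp_def frechet_derivative_add smooth_differentiable)

lemma D_mult:
  "smooth u \<Longrightarrow> smooth w \<Longrightarrow> p \<in> cdom c \<Longrightarrow>
    D i (\<lambda>q. u q * w q) p = u p * D i w p + D i u p * w p"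
  by (simp add: coord_deriv_def comp_def frechet_derivative_mult_real smooth_differentiable)

lemma D_cmult: "smooth u \<Longrightarrow> p \<in> cdom c \<Longrightarrow> D i (\<lambda>q. a * u q) p = a * D i u p"
  by (simp add: D_mult smooth_const)

lemma D_minus: "smooth u \<Longrightarrow> p \<in> cdom c \<Longrightarrow> D i (\<lambda>q. - u q) p = - D i u p"
  using D_cmult[of u p i "- 1"] by simp

lemma D_diff:
  "smooth u \<Longrightarrow> smooth w \<Longrightarrow> p \<in> cdom c \<Longrightarrow> D i (\<lambda>q. u q - w q) p = D i u p - D i w p"
  using D_add[of u "\<lambda>q. - w q" p i] by (simp add: D_minus smooth_minus)

lemma D_sum:
  assumes "\<And>k. k \<in> I \<Longrightarrow> smooth (u k)" "p \<in> cdom c"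
  shows "D i (\<lambda>q. \<Sum>k\<in>I. u k q) p = (\<Sum>k\<in>I. D i (u k) p)"
  using assms(1)
  by (induction I rule: infinite_finite_induct) (simp_all add: D_add smooth_sum assms(2))

lemma D_exp: "smooth u \<Longrightarrow> p \<in> cdom c \<Longrightarrow> D i (\<lambda>q. exp (u q)) p = exp (u p) * D i u p"
  by (simp add: coord_deriv_def comp_def frechet_derivative_exp_real smooth_differentiable)

lemma D_commute:
  assumes "smooth u" "p \<in> cdom c"
  shows "D i (D j u) p = D j (D i u) p"
proof -
  let ?u = "u \<circ> inv_coord c"
  have "D i (D j u) p =
      frechet_derivative (\<lambda>y. frechet_derivative ?u (at y) (axis j 1)) (at (coord c p)) (axis i 1)" for i j
    unfolding coord_deriv_def[of c i "D j u"]
    using frechet_derivative_cong_open[OF open_image _ coord_deriv_inv_coord[of _ j u],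
        where x = "coord c p"] assms(2)
    by (simp add: comp_def)
  then show ?thesis
    using assms frechet_derivative_commute[OF open_image, of "coord c p" ?u]
    by (simp add: smooth_in_chart_def smooth_on_def)
qed

end

subsection \<open>Contraction with the inverse metric\<close>

locale riemannian_chart = riemannian_manifold M \<A> g + manifold_chart M \<A> c
  for M :: "'a topology" and \<A> :: "('a, 'n::finite) chart set" and g c
begin

abbreviation gd :: "'n \<Rightarrow> 'n \<Rightarrow> 'a \<Rightarrow> real" where
  "gd i j \<equiv> \<lambda>p. g c p $ i $ j"

abbreviation gu :: "'n \<Rightarrow> 'n \<Rightarrow> 'a \<Rightarrow> real" where
  "gu i j \<equiv> \<lambda>p. matrix_inv (g c p) $ i $ j"

abbreviation \<Gamma> :: "'n \<Rightarrow> 'n \<Rightarrow> 'n \<Rightarrow> 'a \<Rightarrow> real" where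
  "\<Gamma> \<equiv> christoffel g c"

text \<open>Takes a function of two indices instead of a matrix, so that a lambda can select any two
  slots of a tensor with more indices.\<close>

definition contr :: "'a \<Rightarrow> ('n \<Rightarrow> 'n \<Rightarrow> real) \<Rightarrow> real" where
  "contr p T = (\<Sum>i\<in>UNIV. \<Sum>j\<in>UNIV. gu i j p * T i j)"

lemma contr_add: "contr p (\<lambda>i j. S i j + T i j) = contr p S + contr p T"
  by (simp add: contr_def algebra_simps sum.distrib)

lemma contr_diff: "contr p (\<lambda>i j. S i j - T i j) = contr p S - contr p T"
  by (simp add: contr_def algebra_simps sum_subtractf)

lemma contr_minus: "contr p (\<lambda>i j. - T i j) = - contr p T"
  by (simp add: contr_def sum_negf)

lemma contr_mult_left: "contr p (\<lambda>i j. a * T i j) = a * contr p T"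
  by (simp add: contr_def sum_distrib_left mult.left_commute)

lemma contr_mult_right: "contr p (\<lambda>i j. T i j * a) = contr p T * a"
  by (simp add: contr_def sum_distrib_right mult.assoc)

lemma contr_sum: "contr p (\<lambda>i j. \<Sum>r\<in>I. T r i j) = (\<Sum>r\<in>I. contr p (T r))"
proof -
  have "contr p (\<lambda>i j. \<Sum>r\<in>I. T r i j) = (\<Sum>i\<in>UNIV. \<Sum>r\<in>I. \<Sum>j\<in>UNIV. gu i j p * T r i j)"
    unfolding contr_def sum_distrib_left by (intro sum.cong refl sum.swap)
  also have "\<dots> = (\<Sum>r\<in>I. contr p (T r))"
    unfolding contr_def by (rule sum.swap)
  finally show ?thesis .
qed

lemma contr_commute:
  "contr p (\<lambda>i j. contr p (\<lambda>k l. T i j k l)) = contr p (\<lambda>k l. contr p (\<lambda>i j. T i j k l))"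
proof -
  have "contr p (\<lambda>i j. contr p (\<lambda>k l. T i j k l)) =
      contr p (\<lambda>i j. \<Sum>k\<in>UNIV. \<Sum>l\<in>UNIV. gu k l p * T i j k l)"
    by (simp add: contr_def)
  also have "\<dots> = (\<Sum>k\<in>UNIV. \<Sum>l\<in>UNIV. gu k l p * contr p (\<lambda>i j. T i j k l))"
    by (simp add: contr_sum contr_mult_left)
  finally show ?thesis by (simp add: contr_def)
qed

lemmas contr_linear = contr_add contr_diff contr_minus contr_mult_left contr_mult_right

lemma gd_commute: "p \<in> cdom c \<Longrightarrow> gd i j p = gd j i p"
  using symmetric[OF chart_mem, of p] by (metis transpose_def vec_lambda_beta)

lemma det_metric:
  assumes "p \<in> cdom c"
  shows "det (g c p) \<noteq> 0"
proof -
  have "w = 0" if "g c p *v w = 0" for w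
    using positive_definite[OF chart_mem assms, of w] that by fastforce
  then show ?thesis
    by (metis invertible_det_nz invertible_left_inverse matrix_left_invertible_ker)
qed

lemma metric_mult_inverse:
  assumes "p \<in> cdom c"
  shows "g c p ** matrix_inv (g c p) = mat 1" "matrix_inv (g c p) ** g c p = mat 1"
proof -
  have "\<exists>B. g c p ** B = mat 1 \<and> B ** g c p = mat 1"
    using det_metric[OF assms] invertible_det_nz[of "g c p"] by (simp add: invertible_def)
  then show "g c p ** matrix_inv (g c p) = mat 1" "matrix_inv (g c p) ** g c p = mat 1"
    unfolding matrix_inv_def by (metis (mono_tags, lifting) someI_ex)+
qed

lemma transpose_matrix_inv:
  assumes "p \<in> cdom c"
  shows "transpose (matrix_inv (g c p)) = matrix_inv (g c p)"
proof -
  have "transpose (matrix_inv (g c p)) ** g c p = mat 1"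
    using arg_cong[OF metric_mult_inverse(1)[OF assms], of transpose] symmetric[OF chart_mem assms]
    by (simp add: matrix_transpose_mul transpose_mat)
  then have "transpose (matrix_inv (g c p)) ** (g c p ** matrix_inv (g c p)) = matrix_inv (g c p)"
    by (simp add: matrix_mul_assoc)
  then show ?thesis by (simp add: metric_mult_inverse(1)[OF assms])
qed

lemma gu_commute: "p \<in> cdom c \<Longrightarrow> gu i j p = gu j i p"
  using transpose_matrix_inv[of p] by (metis transpose_def vec_lambda_beta)

lemma contr_transpose: "p \<in> cdom c \<Longrightarrow> contr p (\<lambda>i j. T j i) = contr p T"
  unfolding contr_def by (subst sum.swap) (simp add: gu_commute)

lemma sum_gu_gd: "p \<in> cdom c \<Longrightarrow> (\<Sum>k\<in>UNIV. gu i k p * gd k j p) = (if i = j then 1 else 0)"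
  using arg_cong[OF metric_mult_inverse(2), of p "\<lambda>A. A $ i $ j"]
  by (simp add: matrix_matrix_mult_def mat_def)

lemma sum_gd_gu: "p \<in> cdom c \<Longrightarrow> (\<Sum>k\<in>UNIV. gd i k p * gu k j p) = (if i = j then 1 else 0)"
  using arg_cong[OF metric_mult_inverse(1), of p "\<lambda>A. A $ i $ j"]
  by (simp add: matrix_matrix_mult_def mat_def)

lemma raise_lower:
  assumes "p \<in> cdom c"
  shows "(\<Sum>k\<in>UNIV. gu i k p * (\<Sum>j\<in>UNIV. gd k j p * X j)) = X i"
proof -
  have "(\<Sum>k\<in>UNIV. gu i k p * (\<Sum>j\<in>UNIV. gd k j p * X j)) =
      (\<Sum>j\<in>UNIV. (\<Sum>k\<in>UNIV. gu i k p * gd k j p) * X j)"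
    unfolding sum_distrib_left sum_distrib_right by (subst sum.swap) (simp add: mult.assoc)
  then show ?thesis by (simp add: sum_gu_gd[OF assms] if_distrib[of "\<lambda>x. x * _"] cong: if_cong)
qed

lemma lower_raise:
  assumes "p \<in> cdom c"
  shows "(\<Sum>k\<in>UNIV. gd i k p * (\<Sum>j\<in>UNIV. gu k j p * X j)) = X i"
proof -
  have "(\<Sum>k\<in>UNIV. gd i k p * (\<Sum>j\<in>UNIV. gu k j p * X j)) =
      (\<Sum>j\<in>UNIV. (\<Sum>k\<in>UNIV. gd i k p * gu k j p) * X j)"
    unfolding sum_distrib_left sum_distrib_right by (subst sum.swap) (simp add: mult.assoc)
  then show ?thesis by (simp add: sum_gd_gu[OF assms] if_distrib[of "\<lambda>x. x * _"] cong: if_cong)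
qed

lemma contr_gd:
  assumes "p \<in> cdom c"
  shows "contr p (\<lambda>i j. gd i k p * X j) = X k"
proof -
  have "contr p (\<lambda>i j. gd i k p * X j) = contr p (\<lambda>i j. gd j k p * X i)"
    using contr_transpose[OF assms, of "\<lambda>i j. gd i k p * X j"] by simp
  also have "\<dots> = (\<Sum>i\<in>UNIV. X i * (\<Sum>j\<in>UNIV. gu i j p * gd j k p))"
    by (simp add: contr_def sum_distrib_left mult_ac)
  finally show ?thesis by (simp add: sum_gu_gd[OF assms] if_distrib cong: if_cong)
qed

lemma contr_gd_gd: "p \<in> cdom c \<Longrightarrow> contr p (\<lambda>i j. gd i j p) = real CARD('n)"
proof -
  assume p: "p \<in> cdom c"
  have "(\<Sum>j\<in>UNIV. gu i j p * gd i j p) = 1" for i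
    using sum_gu_gd[OF p, of i i] by (simp add: gd_commute[OF p, of _ i])
  then show ?thesis by (simp add: contr_def)
qed

subsection \<open>Christoffel symbols\<close>

lemma smooth_gd [intro]: "smooth (gd i j)"
  using smooth_metric[OF chart_mem] .

lemma smooth_det:
  assumes "\<And>i j. smooth (\<lambda>q. A q $ i $ j)"
  shows "smooth (\<lambda>q. det (A q :: real^'n^'n))"
  unfolding det_def using assms by (intro smooth_sum smooth_mult smooth_const smooth_prod)

text \<open>By Cramer's rule for the unit vector \<open>axis j 1\<close>, the entry is a quotient of
  two determinants, which are polynomials in the entries of the metric.\<close>

lemma smooth_gu [intro]: "smooth (gu i j)"
proof -
  let ?C = "\<lambda>q. \<chi> k l. if l = i then axis j 1 $ k else g c q $ k $ l"
  have cramer_gu: "gu i j q = det (?C q) * inverse (det (g c q))" if "q \<in> cdom c" for q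
  proof -
    have "g c q *v (matrix_inv (g c q) *v axis j 1) = axis j 1"
      by (simp add: matrix_vector_mul_assoc metric_mult_inverse[OF that])
    then have "matrix_inv (g c q) *v axis j 1 =
        (\<chi> i. det (\<chi> k l. if l = i then axis j 1 $ k else g c q $ k $ l) / det (g c q))"
      using cramer[OF det_metric[OF that]] by blast
    then have "(matrix_inv (g c q) *v axis j 1) $ i = det (?C q) / det (g c q)" by simp
    then show ?thesis by (simp add: matrix_vector_mult_basis column_def divide_inverse)
  qed
  have "smooth (\<lambda>q. ?C q $ k $ l)" for k l by (cases "l = i") auto
  then have "smooth (\<lambda>q. det (?C q) * inverse (det (g c q)))"
    by (intro smooth_mult smooth_inverse smooth_det smooth_gd det_metric)
  then show ?thesis by (subst smooth_cong[OF cramer_gu])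
qed

lemma smooth_contr: "(\<And>i j. smooth (T i j)) \<Longrightarrow> smooth (\<lambda>q. contr q (\<lambda>i j. T i j q))"
  unfolding contr_def by (intro smooth_sum smooth_mult smooth_gu)

text \<open>The Christoffel symbols of the first kind, \<open>\<Gamma>d i j l = g(\<nabla>\<^sub>\<partial>\<^sub>i \<partial>\<^sub>j, \<partial>\<^sub>l)\<close>.\<close>

definition \<Gamma>d :: "'n \<Rightarrow> 'n \<Rightarrow> 'n \<Rightarrow> 'a \<Rightarrow> real" where
  "\<Gamma>d i j l p = 1/2 * (D i (gd j l) p + D j (gd i l) p - D l (gd i j) p)"

lemma christoffel_eq: "\<Gamma> k i j p = (\<Sum>l\<in>UNIV. gu k l p * \<Gamma>d i j l p)"
  by (simp add: christoffel_def \<Gamma>d_def sum_distrib_left mult_ac)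

lemma smooth_\<Gamma>d [intro]: "smooth (\<Gamma>d i j l)"
  unfolding \<Gamma>d_def[abs_def] by (intro smooth_mult smooth_const smooth_add smooth_diff smooth_D smooth_gd)

lemma smooth_christoffel [intro]: "smooth (\<Gamma> k i j)"
  unfolding christoffel_eq[abs_def] by (intro smooth_sum smooth_mult smooth_gu smooth_\<Gamma>d)

lemma D_gd_commute: "p \<in> cdom c \<Longrightarrow> D a (gd i j) p = D a (gd j i) p"
  by (rule D_cong) (auto simp: gd_commute)

lemma \<Gamma>d_commute: "p \<in> cdom c \<Longrightarrow> \<Gamma>d i j l p = \<Gamma>d j i l p"
  by (simp add: \<Gamma>d_def D_gd_commute[of p l i j])

lemma christoffel_commute: "p \<in> cdom c \<Longrightarrow> \<Gamma> k i j p = \<Gamma> k j i p"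
  by (simp add: christoffel_eq \<Gamma>d_commute[of p i j])

lemma \<Gamma>d_eq: "p \<in> cdom c \<Longrightarrow> \<Gamma>d i j l p = (\<Sum>m\<in>UNIV. gd l m p * \<Gamma> m i j p)"
  by (simp add: christoffel_eq lower_raise)

lemma D_gd: "p \<in> cdom c \<Longrightarrow> D a (gd i j) p = \<Gamma>d a i j p + \<Gamma>d a j i p"
  by (simp add: \<Gamma>d_def D_gd_commute[of p _ j i] field_simps)

lemma D_gd_christoffel:
  assumes "p \<in> cdom c"
  shows "D a (gd i j) p = (\<Sum>r\<in>UNIV. \<Gamma> r a i p * gd r j p) + (\<Sum>r\<in>UNIV. \<Gamma> r a j p * gd i r p)"
  unfolding D_gd[OF assms] \<Gamma>d_eq[OF assms] gd_commute[OF assms, of j]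
  by (simp only: mult.commute[of "\<Gamma> _ _ _ _"])

text \<open>The inverse metric is parallel. Differentiating the constant product of inverse metric
  and metric expresses the derivative of the inverse through that of \<open>g\<close>, which metric
  compatibility turns into Christoffel symbols.\<close>

lemma D_gu:
  assumes "p \<in> cdom c"
  shows "D a (gu i j) p = - (\<Sum>r\<in>UNIV. \<Gamma> i a r p * gu r j p) - (\<Sum>r\<in>UNIV. \<Gamma> j a r p * gu i r p)"
proof -
  define X where "X k = (\<Sum>r\<in>UNIV. gu i r p * D a (gd r k) p)" for k
  have *: "(\<Sum>r\<in>UNIV. D a (gu i r) p * gd r k p) = - X k" for k
  proof -
    have "D a (\<lambda>q. \<Sum>r\<in>UNIV. gu i r q * gd r k q) p = D a (\<lambda>q. if i = k then 1 else 0) p"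
      using assms by (intro D_cong) (auto simp: sum_gu_gd)
    then have "(\<Sum>r\<in>UNIV. gu i r p * D a (gd r k) p + D a (gu i r) p * gd r k p) = 0"
      using assms by (simp add: D_sum D_mult smooth_mult smooth_gu smooth_gd)
    then show ?thesis by (simp add: X_def sum.distrib)
  qed
  have "D a (gu i j) p = (\<Sum>k\<in>UNIV. gu j k p * (\<Sum>r\<in>UNIV. gd k r p * D a (gu i r) p))"
    by (simp add: raise_lower[OF assms])
  also have "\<dots> = - (\<Sum>k\<in>UNIV. gu j k p * X k)"
    using * by (simp add: mult.commute gd_commute[OF assms] sum_negf)
  \<comment> \<open>Of the two Christoffel terms in the derivative of \<open>g\<close>, one meets a
    product of metric and inverse and collapses to a single symbol; the other collapses later, on
    raising with \<open>gu j k\<close>.\<close>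
  also have "X k = (\<Sum>r\<in>UNIV. gu i r p * (\<Sum>s\<in>UNIV. gd k s p * \<Gamma> s a r p)) + \<Gamma> i a k p" for k
    using assms by (simp add: X_def D_gd_christoffel distrib_left sum.distrib raise_lower
        mult.commute[of "\<Gamma> _ _ _ _"] gd_commute[of p _ k])
  then have "(\<Sum>k\<in>UNIV. gu j k p * X k) =
      (\<Sum>k\<in>UNIV. gu j k p * (\<Sum>r\<in>UNIV. gu i r p * (\<Sum>s\<in>UNIV. gd k s p * \<Gamma> s a r p)))
      + (\<Sum>k\<in>UNIV. gu j k p * \<Gamma> i a k p)"
    by (simp add: distrib_left sum.distrib)
  also have "(\<Sum>k\<in>UNIV. gu j k p * (\<Sum>r\<in>UNIV. gu i r p * (\<Sum>s\<in>UNIV. gd k s p * \<Gamma> s a r p))) =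
      (\<Sum>r\<in>UNIV. gu i r p * (\<Sum>k\<in>UNIV. gu j k p * (\<Sum>s\<in>UNIV. gd k s p * \<Gamma> s a r p)))"
    unfolding sum_distrib_left[where r = "gu j _ p"] sum_distrib_left[where r = "gu i _ p"]
    by (subst sum.swap) (simp only: mult.left_commute)
  finally show ?thesis
    unfolding raise_lower[OF assms] by (simp add: mult.commute gu_commute[OF assms, of j])
qed

text \<open>Since the inverse metric is parallel, its Christoffel terms can be shifted onto the two
  slots of \<open>T\<close> by renaming summation indices; there they complete the covariant
  derivative.\<close>

lemma D_contr:
  assumes "\<And>i j. smooth (T i j)" "p \<in> cdom c"
  shows "D a (\<lambda>q. contr q (\<lambda>i j. T i j q)) p =
    contr p (\<lambda>i j. D a (T i j) p - (\<Sum>r\<in>UNIV. \<Gamma> r a i p * T r j p) - (\<Sum>r\<in>UNIV. \<Gamma> r a j p * T i r p))"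
proof -
  have "D a (\<lambda>q. contr q (\<lambda>i j. T i j q)) p =
      (\<Sum>i\<in>UNIV. \<Sum>j\<in>UNIV. gu i j p * D a (T i j) p + D a (gu i j) p * T i j p)"
    unfolding contr_def using assms by (simp add: D_sum D_mult smooth_sum smooth_mult smooth_gu)
  also have "\<dots> = contr p (\<lambda>i j. D a (T i j) p)
      - (\<Sum>i\<in>UNIV. \<Sum>j\<in>UNIV. \<Sum>r\<in>UNIV. \<Gamma> i a r p * gu r j p * T i j p)
      - (\<Sum>i\<in>UNIV. \<Sum>j\<in>UNIV. \<Sum>r\<in>UNIV. \<Gamma> j a r p * gu i r p * T i j p)"
    by (simp add: D_gu[OF assms(2)] contr_def sum.distrib sum_subtractf sum_negf
        sum_distrib_right left_diff_distrib)
  also have "(\<Sum>i\<in>UNIV. \<Sum>j\<in>UNIV. \<Sum>r\<in>UNIV. \<Gamma> i a r p * gu r j p * T i j p) =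
      contr p (\<lambda>i j. \<Sum>r\<in>UNIV. \<Gamma> r a i p * T r j p)"
  proof -
    have "(\<Sum>i\<in>UNIV. \<Sum>j\<in>UNIV. \<Sum>r\<in>UNIV. \<Gamma> i a r p * gu r j p * T i j p) =
        (\<Sum>j\<in>UNIV. \<Sum>i\<in>UNIV. \<Sum>r\<in>UNIV. \<Gamma> i a r p * gu r j p * T i j p)"
      by (rule sum.swap)
    also have "\<dots> = (\<Sum>j\<in>UNIV. \<Sum>r\<in>UNIV. \<Sum>i\<in>UNIV. \<Gamma> i a r p * gu r j p * T i j p)"
      by (intro sum.cong refl sum.swap)
    also have "\<dots> = (\<Sum>r\<in>UNIV. \<Sum>j\<in>UNIV. \<Sum>i\<in>UNIV. \<Gamma> i a r p * gu r j p * T i j p)"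
      by (rule sum.swap)
    finally show ?thesis by (simp add: contr_def sum_distrib_left mult_ac)
  qed
  also have "(\<Sum>i\<in>UNIV. \<Sum>j\<in>UNIV. \<Sum>r\<in>UNIV. \<Gamma> j a r p * gu i r p * T i j p) =
      contr p (\<lambda>i j. \<Sum>r\<in>UNIV. \<Gamma> r a j p * T i r p)"
  proof -
    have "(\<Sum>i\<in>UNIV. \<Sum>j\<in>UNIV. \<Sum>r\<in>UNIV. \<Gamma> j a r p * gu i r p * T i j p) =
        (\<Sum>i\<in>UNIV. \<Sum>r\<in>UNIV. \<Sum>j\<in>UNIV. \<Gamma> j a r p * gu i r p * T i j p)"
      by (intro sum.cong refl sum.swap)
    then show ?thesis by (simp add: contr_def sum_distrib_left mult_ac)
  qed
  finally show ?thesis by (simp add: contr_diff)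
qed

end

text \<open>Serves the commutator computation behind the second Bianchi identity, as do the next two
  rules.\<close>

lemma matrix_diff_ldistrib: "(A::real^'n^'m) ** (B - C) = A ** B - A ** C"
  by (vector matrix_matrix_mult_def sum_subtractf right_diff_distrib)

lemma matrix_diff_rdistrib: "(A - B) ** (C::real^'n^'m) = A ** C - B ** C"
  by (vector matrix_matrix_mult_def sum_subtractf left_diff_distrib)

lemma matrix_add_rdistrib: "(A + B) ** (C::real^'n^'m) = A ** C + B ** C"
  by (vector matrix_matrix_mult_def sum.distrib distrib_right)

context riemannian_chart
begin

subsection \<open>Covariant derivatives of covariant tensors\<close>

text \<open>The first index of a covariant derivative is the direction of differentiation.\<close>

definition nabla1 :: "('n \<Rightarrow> 'a \<Rightarrow> real) \<Rightarrow> 'n \<Rightarrow> 'n \<Rightarrow> 'a \<Rightarrow> real" where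
  "nabla1 w a i p = D a (w i) p - (\<Sum>r\<in>UNIV. \<Gamma> r a i p * w r p)"

definition nabla2 :: "('n \<Rightarrow> 'n \<Rightarrow> 'a \<Rightarrow> real) \<Rightarrow> 'n \<Rightarrow> 'n \<Rightarrow> 'n \<Rightarrow> 'a \<Rightarrow> real" where
  "nabla2 T a i j p = D a (T i j) p
     - (\<Sum>r\<in>UNIV. \<Gamma> r a i p * T r j p) - (\<Sum>r\<in>UNIV. \<Gamma> r a j p * T i r p)"

definition nabla4 ::
    "('n \<Rightarrow> 'n \<Rightarrow> 'n \<Rightarrow> 'n \<Rightarrow> 'a \<Rightarrow> real) \<Rightarrow> 'n \<Rightarrow> 'n \<Rightarrow> 'n \<Rightarrow> 'n \<Rightarrow> 'n \<Rightarrow> 'a \<Rightarrow> real" where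
  "nabla4 T a i j k l p = D a (T i j k l) p
     - (\<Sum>r\<in>UNIV. \<Gamma> r a i p * T r j k l p) - (\<Sum>r\<in>UNIV. \<Gamma> r a j p * T i r k l p)
     - (\<Sum>r\<in>UNIV. \<Gamma> r a k p * T i j r l p) - (\<Sum>r\<in>UNIV. \<Gamma> r a l p * T i j k r p)"

lemma contr_nabla2:
  assumes "\<And>i j. smooth (T i j)" "p \<in> cdom c"
  shows "contr p (\<lambda>i j. nabla2 T a i j p) = D a (\<lambda>q. contr q (\<lambda>i j. T i j q)) p"
  by (simp add: nabla2_def D_contr[OF assms])

text \<open>Slots 1 and 4 are those of \<open>Rm\<close> whose contraction is the Ricci tensor; the
  Christoffel terms of the other two slots pass through the contraction untouched.\<close>

lemma contr_nabla4_14: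
  assumes "\<And>i j k l. smooth (T i j k l)" "p \<in> cdom c"
  shows "contr p (\<lambda>i l. nabla4 T a i j k l p) =
    nabla2 (\<lambda>j k q. contr q (\<lambda>i l. T i j k l q)) a j k p"
  by (simp add: nabla2_def nabla4_def D_contr[OF assms(1) assms(2)] contr_diff contr_sum contr_mult_left)

lemma nabla2_cong:
  assumes "p \<in> cdom c" "\<And>i j q. q \<in> cdom c \<Longrightarrow> S i j q = T i j q"
  shows "nabla2 S a i j p = nabla2 T a i j p"
proof -
  have "D a (S i j) p = D a (T i j) p" using assms by (rule D_cong)
  then show ?thesis by (simp add: nabla2_def assms)
qed

lemma nabla2_gd: "p \<in> cdom c \<Longrightarrow> nabla2 gd a i j p = 0"
  by (simp add: nabla2_def D_gd_christoffel)

lemma nabla2_mult: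
  assumes "smooth u" "\<And>i j. smooth (T i j)" "p \<in> cdom c"
  shows "nabla2 (\<lambda>i j q. u q * T i j q) a i j p = D a u p * T i j p + u p * nabla2 T a i j p"
  using assms by (simp add: nabla2_def D_mult right_diff_distrib sum_distrib_left mult_ac)

lemma nabla2_diff:
  assumes "\<And>i j. smooth (S i j)" "\<And>i j. smooth (T i j)" "p \<in> cdom c"
  shows "nabla2 (\<lambda>i j q. S i j q - T i j q) a i j p = nabla2 S a i j p - nabla2 T a i j p"
  using assms by (simp add: nabla2_def D_diff right_diff_distrib sum_subtractf)

subsection \<open>Curvature\<close>

lemma smooth_riemann [intro]: "smooth (riemann g c l i j k)"
  unfolding riemann_def[abs_def]
  by (intro smooth_add smooth_diff smooth_sum smooth_mult smooth_D smooth_christoffel)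

lemma riemann_swap: "riemann g c l i j k p = - riemann g c l j i k p"
  by (simp add: riemann_def sum_subtractf)

text \<open>\<open>Rm i j k l = g(R(\<partial>\<^sub>i, \<partial>\<^sub>j)\<partial>\<^sub>k, \<partial>\<^sub>l)\<close>.\<close>

definition Rm :: "'n \<Rightarrow> 'n \<Rightarrow> 'n \<Rightarrow> 'n \<Rightarrow> 'a \<Rightarrow> real" where
  "Rm i j k l p = (\<Sum>m\<in>UNIV. gd l m p * riemann g c m i j k p)"

abbreviation Ric :: "'n \<Rightarrow> 'n \<Rightarrow> 'a \<Rightarrow> real" where
  "Ric i j \<equiv> \<lambda>p. ricci g c p $ i $ j"

lemma smooth_Rm [intro]: "smooth (Rm i j k l)"
  unfolding Rm_def[abs_def] by (intro smooth_sum smooth_mult smooth_gd smooth_riemann)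

lemma smooth_Ric [intro]: "smooth (Ric i j)"
  unfolding ricci_def vec_lambda_beta by (intro smooth_sum smooth_riemann)

lemma riemann_eq: "p \<in> cdom c \<Longrightarrow> riemann g c m i j k p = (\<Sum>l\<in>UNIV. gu m l p * Rm i j k l p)"
  by (simp add: Rm_def raise_lower)

lemma Ric_eq: "p \<in> cdom c \<Longrightarrow> Ric j k p = contr p (\<lambda>i l. Rm i j k l p)"
  by (simp add: ricci_def riemann_eq contr_def)

lemma scalar_curvature_eq: "scalar_curvature g c p = contr p (\<lambda>i j. Ric i j p)"
  by (simp add: scalar_curvature_def metric_trace_def contr_def)

text \<open>As a contraction of symbols of the first kind, the product shows its symmetry under
  exchange of the two factors.\<close>

lemma sum_\<Gamma>d_christoffel:
  "(\<Sum>m\<in>UNIV. \<Gamma>d i l m p * \<Gamma> m j k p) = contr p (\<lambda>r s. \<Gamma>d i l r p * \<Gamma>d j k s p)"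
  by (simp add: christoffel_eq contr_def sum_distrib_left mult_ac)

lemma sum_gd_D_christoffel:
  assumes p: "p \<in> cdom c"
  shows "(\<Sum>m\<in>UNIV. gd l m p * D i (\<Gamma> m j k) p) = D i (\<Gamma>d j k l) p
    - (\<Sum>m\<in>UNIV. \<Gamma>d i l m p * \<Gamma> m j k p) - (\<Sum>m\<in>UNIV. \<Gamma>d i m l p * \<Gamma> m j k p)"
proof -
  have "D i (\<Gamma>d j k l) p = D i (\<lambda>q. \<Sum>m\<in>UNIV. gd l m q * \<Gamma> m j k q) p"
    using p by (intro D_cong) (auto simp: \<Gamma>d_eq)
  then show ?thesis
    using p by (simp add: D_sum D_mult smooth_mult smooth_gd smooth_christoffel D_gd
        sum.distrib distrib_right)
qed

text \<open>The classical formula in second derivatives of the metric, from which the algebraic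
  symmetries can be read off. Lowering the index inside the derivative of \<open>\<Gamma>\<close>
  costs two correction sums; one cancels the quadratic part of \<open>riemann\<close>, the other
  survives.\<close>

lemma Rm_eq:
  assumes p: "p \<in> cdom c"
  shows "Rm i j k l p =
    1/2 * (D i (D k (gd j l)) p - D i (D l (gd j k)) p - D j (D k (gd i l)) p + D j (D l (gd i k)) p)
    - contr p (\<lambda>r s. \<Gamma>d i l r p * \<Gamma>d j k s p) + contr p (\<lambda>r s. \<Gamma>d j l r p * \<Gamma>d i k s p)"
proof -
  have quad: "(\<Sum>m\<in>UNIV. gd l m p * (\<Sum>r\<in>UNIV. \<Gamma> m i r p * \<Gamma> r j k p)) =
      (\<Sum>m\<in>UNIV. \<Gamma>d i m l p * \<Gamma> m j k p)" for i j
  proof -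
    have "(\<Sum>m\<in>UNIV. gd l m p * (\<Sum>r\<in>UNIV. \<Gamma> m i r p * \<Gamma> r j k p)) =
        (\<Sum>r\<in>UNIV. \<Sum>m\<in>UNIV. gd l m p * \<Gamma> m i r p * \<Gamma> r j k p)"
      unfolding sum_distrib_left by (subst sum.swap) (simp add: mult.assoc)
    then show ?thesis by (simp add: \<Gamma>d_eq[OF p] sum_distrib_right)
  qed
  have DD: "D i (\<Gamma>d j k l) p =
      1/2 * (D i (D j (gd k l)) p + D i (D k (gd j l)) p - D i (D l (gd j k)) p)" for i j
    unfolding \<Gamma>d_def[abs_def] using p
    by (subst D_cmult) (simp_all add: D_add D_diff smooth_add smooth_diff smooth_D smooth_gd)
  have "Rm i j k l p = D i (\<Gamma>d j k l) p - (\<Sum>m\<in>UNIV. \<Gamma>d i l m p * \<Gamma> m j k p)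
      - D j (\<Gamma>d i k l) p + (\<Sum>m\<in>UNIV. \<Gamma>d j l m p * \<Gamma> m i k p)"
    by (simp add: Rm_def riemann_def right_diff_distrib distrib_left sum.distrib sum_subtractf
        sum_gd_D_christoffel[OF p] quad)
  \<comment> \<open>The second derivatives of \<open>gd k l\<close> from the two halves cancel
    because coordinate derivatives commute.\<close>
  then show ?thesis
    using D_commute[OF smooth_gd p, of i j k l] unfolding DD sum_\<Gamma>d_christoffel by argo
qed

section \<open>Symmetries of the curvature tensor and the Bianchi identities\<close>

lemma DD_gd_commute: "p \<in> cdom c \<Longrightarrow> D a (D b (gd i j)) p = D a (D b (gd j i)) p"
  by (rule D_cong) (auto simp: D_gd_commute)

lemma contr_\<Gamma>d_commute:
  "p \<in> cdom c \<Longrightarrow> contr p (\<lambda>r s. \<Gamma>d i l r p * \<Gamma>d j k s p) = contr p (\<lambda>r s. \<Gamma>d j k r p * \<Gamma>d i l s p)"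
  by (subst contr_transpose[symmetric], assumption) (intro arg_cong[where f = "contr p"] ext mult.commute)

lemma Rm_swap_12: "Rm i j k l p = - Rm j i k l p"
  by (simp add: Rm_def riemann_swap[of _ i j] sum_negf)

lemma Rm_swap_34:
  assumes "p \<in> cdom c"
  shows "Rm i j k l p = - Rm i j l k p"
  using contr_\<Gamma>d_commute[OF assms, of i l j k] contr_\<Gamma>d_commute[OF assms, of j l i k]
  unfolding Rm_eq[OF assms] by argo

lemma Rm_swap_pairs:
  assumes "p \<in> cdom c"
  shows "Rm i j k l p = Rm k l i j p"
proof -
  have 1: "contr p (\<lambda>r s. \<Gamma>d k j r p * \<Gamma>d l i s p) = contr p (\<lambda>r s. \<Gamma>d i l r p * \<Gamma>d j k s p)"
    using contr_\<Gamma>d_commute[OF assms, of i l j k]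
    by (simp add: \<Gamma>d_commute[OF assms, of l i] \<Gamma>d_commute[OF assms, of k j])
  have 2: "contr p (\<lambda>r s. \<Gamma>d l j r p * \<Gamma>d k i s p) = contr p (\<lambda>r s. \<Gamma>d j l r p * \<Gamma>d i k s p)"
    by (simp add: \<Gamma>d_commute[OF assms, of l j] \<Gamma>d_commute[OF assms, of k i])
  have 3: "D k (D i (gd l j)) p = D i (D k (gd j l)) p" "D k (D j (gd l i)) p = D j (D k (gd i l)) p"
    "D l (D i (gd k j)) p = D i (D l (gd j k)) p" "D l (D j (gd k i)) p = D j (D l (gd i k)) p"
    using assms by (simp_all add: DD_gd_commute[of p _ _ l] DD_gd_commute[of p _ _ k i]
        DD_gd_commute[of p _ _ k j] D_commute[OF smooth_gd, of p k] D_commute[OF smooth_gd, of p l])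
  show ?thesis unfolding Rm_eq[OF assms] 1 2 3 by simp
qed

text \<open>Pair symmetry and both antisymmetries reverse all four indices of \<open>Rm\<close>,
  which exchanges \<open>j\<close> and \<open>k\<close> and transposes the contracted pair.\<close>

lemma Ric_commute:
  assumes "p \<in> cdom c"
  shows "Ric j k p = Ric k j p"
proof -
  have "Rm i j k l p = Rm l k j i p" for i l
    using Rm_swap_pairs[OF assms, of i j k l] Rm_swap_12[of k l i j] Rm_swap_34[OF assms, of l k i j]
    by simp
  then have "Ric j k p = contr p (\<lambda>i l. Rm l k j i p)"
    using assms by (simp add: Ric_eq)
  then show ?thesis
    using assms contr_transpose[OF assms, of "\<lambda>i l. Rm i k j l p"] by (simp add: Ric_eq)
qed

text \<open>With \<open>\<nabla>\<^sub>a = \<partial>\<^sub>a + A\<^sub>a\<close> acting on vector fields, where \<open>A\<^sub>a = (\<Gamma>\<^sup>m\<^sub>a\<^sub>k)\<^sub>m\<^sub>k\<close>, this is the Jacobi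
  identity for the commutators of \<open>\<nabla>\<^sub>a, \<nabla>\<^sub>i, \<nabla>\<^sub>j\<close>.\<close>

lemma second_bianchi_connection:
  fixes a i j k m :: 'n
  assumes p: "p \<in> cdom c"
  defines "B \<equiv> \<lambda>a i j. D a (riemann g c m i j k) p
    + (\<Sum>r\<in>UNIV. \<Gamma> m a r p * riemann g c r i j k p) - (\<Sum>r\<in>UNIV. \<Gamma> r a k p * riemann g c m i j r p)"
  shows "B a i j + B i j a + B j a i = 0"
proof -
  define A where "A a = (\<chi> m k. \<Gamma> m a k p)" for a
  define A1 where "A1 a i = (\<chi> m k. D a (\<Gamma> m i k) p)" for a i
  define A2 where "A2 a i j = (\<chi> m k. D a (D i (\<Gamma> m j k)) p)" for a i j
  \<comment> \<open>The curvature as a matrix-valued 2-form, dA plus the commutator of A with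
    itself; \<open>A1\<close>, \<open>A2\<close> and \<open>F1\<close> record coordinate derivatives
    at \<open>p\<close>.\<close>
  define F where "F i j = A1 i j - A1 j i + A i ** A j - A j ** A i" for i j
  define F1 where "F1 a i j = A2 a i j - A2 a j i + A1 a i ** A j + A i ** A1 a j
    - A1 a j ** A i - A j ** A1 a i" for a i j
  have A2: "A2 a i j = A2 i a j" for a i j
    by (simp add: A2_def D_commute[OF smooth_christoffel p, of a i])
  have F: "riemann g c m i j k p = F i j $ m $ k" for m i j k
    by (simp add: F_def A_def A1_def riemann_def matrix_matrix_mult_def sum_subtractf)
  have F1: "D a (riemann g c m i j k) p = F1 a i j $ m $ k" for a m i j k
    unfolding riemann_def[abs_def] using p
    by (simp add: F1_def A_def A1_def A2_def matrix_matrix_mult_def sum_subtractf sum.distrib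
        D_add D_diff D_sum D_mult smooth_add smooth_diff smooth_D smooth_sum smooth_mult smooth_christoffel)
  have B: "B a i j = (F1 a i j + A a ** F i j - F i j ** A a) $ m $ k" for a i j
    by (simp add: B_def F F1 A_def matrix_matrix_mult_def mult.commute)
  \<comment> \<open>The second derivatives \<open>A2\<close> cancel by their symmetry; all other
    terms cancel by associativity and distributivity alone.\<close>
  have "(F1 a i j + A a ** F i j - F i j ** A a) + (F1 i j a + A i ** F j a - F j a ** A i)
      + (F1 j a i + A j ** F a i - F a i ** A j) = 0"
    unfolding F_def F1_def
    by (simp add: A2[of i a] A2[of j a] A2[of j i] matrix_add_ldistrib matrix_add_rdistrib
        matrix_diff_ldistrib matrix_diff_rdistrib matrix_mul_assoc)
  then show ?thesis
    unfolding B by (metis vector_add_component zero_index)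
qed

text \<open>Lowering an index commutes with covariant differentiation: one part of the derivative of
  the metric cancels the correction for slot \<open>l\<close>, the other becomes the connection term
  of the raised index.\<close>

lemma nabla4_Rm:
  assumes p: "p \<in> cdom c"
  shows "nabla4 Rm a i j k l p = (\<Sum>m\<in>UNIV. gd l m p * (D a (riemann g c m i j k) p
    + (\<Sum>r\<in>UNIV. \<Gamma> m a r p * riemann g c r i j k p) - (\<Sum>r\<in>UNIV. \<Gamma> r a k p * riemann g c m i j r p)
    - (\<Sum>r\<in>UNIV. \<Gamma> r a i p * riemann g c m r j k p) - (\<Sum>r\<in>UNIV. \<Gamma> r a j p * riemann g c m i r k p)))"
proof -
  have swap: "(\<Sum>r\<in>UNIV. X r * (\<Sum>m\<in>UNIV. gd l m p * Y r m)) =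
      (\<Sum>m\<in>UNIV. gd l m p * (\<Sum>r\<in>UNIV. X r * Y r m))" for X Y
    unfolding sum_distrib_left by (subst sum.swap) (simp add: mult_ac)
  have swap': "(\<Sum>m\<in>UNIV. (\<Sum>r\<in>UNIV. X r m * Y r) * Z m) = (\<Sum>r\<in>UNIV. Y r * (\<Sum>m\<in>UNIV. X r m * Z m))"
    for X Z and Y :: "'n \<Rightarrow> real"
    unfolding sum_distrib_left sum_distrib_right by (subst sum.swap) (simp add: mult_ac)
  have swap'': "(\<Sum>m\<in>UNIV. (\<Sum>r\<in>UNIV. Y r * X r m) * Z m) = (\<Sum>r\<in>UNIV. Y r * (\<Sum>m\<in>UNIV. X r m * Z m))"
    for X Z and Y :: "'n \<Rightarrow> real"
    unfolding sum_distrib_left sum_distrib_right by (subst sum.swap) (simp add: mult_ac)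
  have "D a (Rm i j k l) p = (\<Sum>m\<in>UNIV. gd l m p * D a (riemann g c m i j k) p)
      + (\<Sum>m\<in>UNIV. D a (gd l m) p * riemann g c m i j k p)"
    unfolding Rm_def[abs_def] using p
    by (simp add: D_sum D_mult smooth_mult smooth_gd smooth_riemann sum.distrib)
  also have "(\<Sum>m\<in>UNIV. D a (gd l m) p * riemann g c m i j k p) =
      (\<Sum>r\<in>UNIV. \<Gamma> r a l p * Rm i j k r p)
      + (\<Sum>m\<in>UNIV. gd l m p * (\<Sum>r\<in>UNIV. \<Gamma> m a r p * riemann g c r i j k p))"
    unfolding Rm_def by (simp add: D_gd_christoffel[OF p] distrib_right sum.distrib swap' swap'')
  finally show ?thesis
    unfolding nabla4_def
    by (simp add: Rm_def[of _ _ _ l p] swap right_diff_distrib distrib_left sum.distrib sum_subtractf)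
qed

lemma second_bianchi:
  assumes p: "p \<in> cdom c"
  shows "nabla4 Rm a i j k l p + nabla4 Rm i j a k l p + nabla4 Rm j a i k l p = 0"
proof -
  \<comment> \<open>\<open>second_bianchi_connection\<close> omits the corrections for the slots
    \<open>i\<close> and \<open>j\<close>. In the cyclic sum they cancel in pairs, as the connection
    is torsion-free and the curvature antisymmetric.\<close>
  have *: "(\<Sum>r\<in>UNIV. \<Gamma> r x y p * riemann g c m r z k p) + (\<Sum>r\<in>UNIV. \<Gamma> r y x p * riemann g c m z r k p) = 0"
    for m x y z
    by (simp add: christoffel_commute[OF p, of _ x y] riemann_swap[of _ z] sum_negf)
  define X where "X a i j m = D a (riemann g c m i j k) p
    + (\<Sum>r\<in>UNIV. \<Gamma> m a r p * riemann g c r i j k p) - (\<Sum>r\<in>UNIV. \<Gamma> r a k p * riemann g c m i j r p)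
    - (\<Sum>r\<in>UNIV. \<Gamma> r a i p * riemann g c m r j k p) - (\<Sum>r\<in>UNIV. \<Gamma> r a j p * riemann g c m i r k p)"
    for a i j m
  have "X a i j m + X i j a m + X j a i m = 0" for m
    using second_bianchi_connection[OF p, of a m i j k] *[of a i m j] *[of i j m a] *[of j a m i]
    unfolding X_def by linarith
  then have "(\<Sum>m\<in>UNIV. gd l m p * (X a i j m + X i j a m + X j a i m)) = 0"
    by simp
  then show ?thesis
    unfolding nabla4_Rm[OF p] X_def[symmetric] by (simp only: distrib_left sum.distrib)
qed

text \<open>Contracting the second Bianchi identity over \<open>i\<close>, \<open>l\<close> and
  \<open>j\<close>, \<open>k\<close> turns its first term into dR and each of the other two into
  -div Ric.\<close>

lemma contracted_bianchi:
  assumes p: "p \<in> cdom c"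
  shows "D a (scalar_curvature g c) p = 2 * contr p (\<lambda>i j. nabla2 Ric i j a p)"
proof -
  have scal: "D a (scalar_curvature g c) p = contr p (\<lambda>j k. nabla2 Ric a j k p)"
    unfolding contr_nabla2[OF smooth_Ric p] scalar_curvature_eq[symmetric] ..
  have 1: "contr p (\<lambda>i l. nabla4 Rm a i j k l p) = nabla2 Ric a j k p" for a j k
    unfolding contr_nabla4_14[OF smooth_Rm p]
    by (rule nabla2_cong[OF p]) (simp add: Ric_eq)
  have neg12: "nabla4 Rm a i j k l p = - nabla4 Rm a j i k l p" for a i j k l
  proof -
    have "D a (Rm i j k l) p = D a (\<lambda>q. - Rm j i k l q) p"
      using p by (intro D_cong) (auto simp: Rm_swap_12[of i])
    then show ?thesis
      using p by (simp add: nabla4_def D_minus smooth_Rm Rm_swap_12[of _ j] Rm_swap_12[of i] sum_negf)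
  qed
  have neg34: "nabla4 Rm a i j k l p = - nabla4 Rm a i j l k p" for a i j k l
  proof -
    have "D a (Rm i j k l) p = D a (\<lambda>q. - Rm i j l k q) p"
      using p by (intro D_cong) (auto simp: Rm_swap_34[of _ i j k])
    then show ?thesis
      using p by (simp add: nabla4_def D_minus smooth_Rm Rm_swap_34[of p _ _ k] Rm_swap_34[of p _ _ _ l] sum_negf)
  qed
  have sym: "nabla2 Ric a i j p = nabla2 Ric a j i p" for a i j
  proof -
    have "D a (Ric i j) p = D a (Ric j i) p"
      using p by (intro D_cong) (auto simp: Ric_commute[of _ i j])
    then show ?thesis by (simp add: nabla2_def Ric_commute[OF p, of i] Ric_commute[OF p, of _ j])
  qed
  \<comment> \<open>Contracting \<open>j\<close>, \<open>k\<close> first and exchanging the last two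
    slots brings the contracted pair into positions 1 and 4, at the price of a sign.\<close>
  have 2: "contr p (\<lambda>j k. contr p (\<lambda>i l. nabla4 Rm i j a k l p)) =
      - contr p (\<lambda>i l. nabla2 Ric i l a p)"
  proof -
    have "contr p (\<lambda>j k. contr p (\<lambda>i l. nabla4 Rm i j a k l p)) =
        contr p (\<lambda>i l. contr p (\<lambda>j k. nabla4 Rm i j a k l p))"
      by (rule contr_commute)
    also have "\<dots> = contr p (\<lambda>i l. - contr p (\<lambda>j k. nabla4 Rm i j a l k p))"
      by (subst neg34) (simp only: contr_minus)
    also have "\<dots> = - contr p (\<lambda>i l. nabla2 Ric i l a p)"
      by (simp add: 1 contr_minus sym[of _ a])
    finally show ?thesis .
  qed
  have "0 = contr p (\<lambda>j k. contr p (\<lambda>i l.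
      nabla4 Rm a i j k l p + nabla4 Rm i j a k l p + nabla4 Rm j a i k l p))"
    using second_bianchi[OF p] by (simp add: contr_def)
  also have "\<dots> = contr p (\<lambda>j k. nabla2 Ric a j k p) + contr p (\<lambda>j k. contr p (\<lambda>i l. nabla4 Rm i j a k l p))
      + contr p (\<lambda>j k. contr p (\<lambda>i l. nabla4 Rm j a i k l p))"
    by (simp add: contr_add 1)
  also have "contr p (\<lambda>j k. contr p (\<lambda>i l. nabla4 Rm j a i k l p)) = - contr p (\<lambda>j k. nabla2 Ric j k a p)"
    by (subst neg12) (simp add: contr_minus 1 sym[of _ a])
  finally show ?thesis using 2 scal by simp
qed

end

text \<open>Needed because \<open>(sqrt x)\<^sup>2 = \<bar>x\<bar>\<close>: the sum under the root of \<^const>\<open>tensor_norm\<close> has to be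
  shown nonnegative. The proof eliminates one index at a time by completing the square, as in a
  Cholesky decomposition of \<open>G\<close>.\<close>

lemma sum_mult_nonneg_of_positive_forms:
  fixes G B :: "'b \<Rightarrow> 'b \<Rightarrow> real"
  assumes "finite I" and "\<And>i j. G i j = G j i"
    and "\<And>w. \<exists>i\<in>I. w i \<noteq> 0 \<Longrightarrow> 0 < (\<Sum>i\<in>I. \<Sum>j\<in>I. w i * w j * G i j)"
    and "\<And>w. 0 \<le> (\<Sum>i\<in>I. \<Sum>j\<in>I. w i * w j * B i j)"
  shows "0 \<le> (\<Sum>i\<in>I. \<Sum>j\<in>I. G i j * B i j)"
  using assms
proof (induction I arbitrary: G)
  case empty
  then show ?case by simp
next
  case (insert k I)
  let ?J = "insert k I"
  \<comment> \<open>The Schur complement of the pivot \<open>G k k\<close>; its row and column at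
    \<open>k\<close> vanish.\<close>
  define G' where "G' i j = G i j - G i k * G j k / G k k" for i j
  note sym = insert.prems(1)
  have restrict: "(\<Sum>i\<in>?J. \<Sum>j\<in>?J. F i j) = (\<Sum>i\<in>I. \<Sum>j\<in>I. F i j)"
    if "\<And>i. F i k = 0" "\<And>j. F k j = 0" for F :: "'b \<Rightarrow> 'b \<Rightarrow> real"
    using insert.hyps that by simp
  have "0 < (\<Sum>i\<in>?J. \<Sum>j\<in>?J. of_bool (i = k) * of_bool (j = k) * G i j)"
    by (rule insert.prems(2)) simp
  also have "(\<Sum>i\<in>?J. \<Sum>j\<in>?J. of_bool (i = k) * of_bool (j = k) * G i j) = G k k"
  proof -
    have "(\<Sum>i\<in>?J. \<Sum>j\<in>?J. of_bool (i = k) * of_bool (j = k) * G i j) =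
        (\<Sum>i\<in>?J. if i = k then \<Sum>j\<in>?J. if j = k then G k j else 0 else 0)"
      by (auto intro!: sum.cong)
    then show ?thesis using insert.hyps by simp
  qed
  finally have Gkk: "G k k > 0" .
  have G'k: "G' i k = 0" "G' k j = 0" for i j
    using Gkk sym[of k j] by (simp_all add: G'_def)
  have split: "(\<Sum>i\<in>?J. \<Sum>j\<in>?J. F i j * G i j) = (\<Sum>i\<in>I. \<Sum>j\<in>I. F i j * G' i j)
      + (\<Sum>i\<in>?J. \<Sum>j\<in>?J. F i j * (G i k * G j k)) / G k k" for F
  proof -
    have "(\<Sum>i\<in>?J. \<Sum>j\<in>?J. F i j * G' i j) = (\<Sum>i\<in>I. \<Sum>j\<in>I. F i j * G' i j)"
      by (rule restrict) (simp_all add: G'k)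
    moreover have "F i j * G i j = F i j * G' i j + F i j * (G i k * G j k) / G k k" for i j
      using Gkk by (simp add: G'_def field_simps)
    then have "(\<Sum>i\<in>?J. \<Sum>j\<in>?J. F i j * G i j) = (\<Sum>i\<in>?J. \<Sum>j\<in>?J. F i j * G' i j)
      + (\<Sum>i\<in>?J. \<Sum>j\<in>?J. F i j * (G i k * G j k)) / G k k"
      by (simp only: sum.distrib sum_divide_distrib)
    ultimately show ?thesis by simp
  qed
  have "0 \<le> (\<Sum>i\<in>I. \<Sum>j\<in>I. G' i j * B i j)"
  proof (rule insert.IH)
    show "G' i j = G' j i" for i j by (simp add: G'_def sym[of i j])
    show "0 \<le> (\<Sum>i\<in>I. \<Sum>j\<in>I. w i * w j * B i j)" for w
    proof -
      \<comment> \<open>\<open>B\<close> stays fixed in the induction: its form on \<open>I\<close>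
        is the old form on vectors vanishing at \<open>k\<close>.\<close>
      have "(\<Sum>i\<in>?J. \<Sum>j\<in>?J. (w(k := 0)) i * (w(k := 0)) j * B i j) =
          (\<Sum>i\<in>I. \<Sum>j\<in>I. (w(k := 0)) i * (w(k := 0)) j * B i j)"
        by (rule restrict) simp_all
      also have "\<dots> = (\<Sum>i\<in>I. \<Sum>j\<in>I. w i * w j * B i j)"
        using insert.hyps by (intro sum.cong refl) (auto simp: fun_upd_def)
      finally show ?thesis using insert.prems(3)[of "w(k := 0)"] by simp
    qed
    show "0 < (\<Sum>i\<in>I. \<Sum>j\<in>I. w i * w j * G' i j)" if w: "\<exists>i\<in>I. w i \<noteq> 0" for w
    proof -
      \<comment> \<open>The value at \<open>k\<close> makes \<open>z\<close> orthogonal, with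
        respect to \<open>G\<close>, to the basis vector of index \<open>k\<close>. This kills the
        rank-one term, so \<open>G'\<close> at \<open>w\<close> equals \<open>G\<close> at
        \<open>z\<close>.\<close>
      define z where "z = w(k := - (\<Sum>i\<in>I. w i * G i k) / G k k)"
      have z: "z i = w i" if "i \<in> I" for i using that insert.hyps by (auto simp: z_def)
      have "(\<Sum>i\<in>?J. z i * G i k) = z k * G k k + (\<Sum>i\<in>I. z i * G i k)"
        using insert.hyps by simp
      also have "(\<Sum>i\<in>I. z i * G i k) = (\<Sum>i\<in>I. w i * G i k)" by (simp add: z)
      also have "z k * G k k = - (\<Sum>i\<in>I. w i * G i k)" using Gkk by (simp add: z_def)
      finally have "(\<Sum>i\<in>?J. z i * G i k) = 0" by simp
      then have "(\<Sum>i\<in>?J. z i * G i k) * (\<Sum>j\<in>?J. z j * G j k) = 0" by simp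
      then have "(\<Sum>i\<in>?J. \<Sum>j\<in>?J. z i * z j * (G i k * G j k)) = 0"
        unfolding sum_product by (simp add: mult_ac)
      moreover have "0 < (\<Sum>i\<in>?J. \<Sum>j\<in>?J. z i * z j * G i j)"
        using w z by (intro insert.prems(2)) auto
      ultimately have "0 < (\<Sum>i\<in>I. \<Sum>j\<in>I. z i * z j * G' i j)"
        by (simp only: split[of "\<lambda>i j. z i * z j"])
      then show ?thesis by (simp add: z)
    qed
  qed
  \<comment> \<open>The rank-one part contributes the form of \<open>B\<close> at the vector
    \<open>\<lambda>i. G i k\<close>.\<close>
  moreover have "0 \<le> (\<Sum>i\<in>?J. \<Sum>j\<in>?J. G i k * G j k * B i j)"
    by (rule insert.prems(3))
  ultimately show ?case
    using split[of B] Gkk by (simp only: mult.commute[of "B _ _"]) simp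
qed

section \<open>Positivity of the inverse metric and the norm of the trace-free Ricci tensor\<close>

context riemannian_chart
begin

text \<open>Raising the index of \<open>w\<close> gives a vector \<open>y\<close> whose squared
  length in the metric is this contraction, so the inverse metric inherits positivity.\<close>

lemma contr_square_nonneg:
  assumes p: "p \<in> cdom c"
  shows "0 \<le> contr p (\<lambda>j l. w j * w l)"
    and "\<exists>i. w i \<noteq> 0 \<Longrightarrow> 0 < contr p (\<lambda>j l. w j * w l)"
proof -
  define y where "y = matrix_inv (g c p) *v (\<chi> i. w i)"
  have gy: "g c p *v y = (\<chi> i. w i)"
    by (simp add: y_def matrix_vector_mul_assoc metric_mult_inverse[OF p])
  have eq: "contr p (\<lambda>j l. w j * w l) = y \<bullet> (g c p *v y)"
    unfolding gy
    by (simp add: y_def contr_def inner_vec_def matrix_vector_mult_def sum_distrib_left sum_distrib_right mult_ac)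
  show "0 \<le> contr p (\<lambda>j l. w j * w l)"
    unfolding eq using positive_definite[OF chart_mem p, of y] by (cases "y = 0") auto
  assume nonzero: "\<exists>i. w i \<noteq> 0"
  have "y \<noteq> 0"
  proof
    assume "y = 0"
    then have "(\<chi> i. w i) = 0" using gy by simp
    then show False using nonzero by (simp add: vec_eq_iff)
  qed
  then show "0 < contr p (\<lambda>j l. w j * w l)"
    unfolding eq by (rule positive_definite[OF chart_mem p])
qed

text \<open>The inner contraction is the Gram matrix of the rows of \<open>T\<close>, hence
  semidefinite; its pairing with the positive definite inverse metric is nonnegative.\<close>

lemma contr_contr_square_nonneg:
  assumes p: "p \<in> cdom c"
  shows "0 \<le> contr p (\<lambda>i k. contr p (\<lambda>j l. T i j * T k l))"
proof -
  define B where "B i k = contr p (\<lambda>j l. T i j * T k l)" for i k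
  have "(\<Sum>i\<in>UNIV. \<Sum>k\<in>UNIV. w i * w k * B i k) =
      contr p (\<lambda>j l. (\<Sum>i\<in>UNIV. w i * T i j) * (\<Sum>k\<in>UNIV. w k * T k l))" for w
    by (simp only: B_def sum_product contr_sum contr_mult_left[symmetric] mult_ac)
  then have psd: "0 \<le> (\<Sum>i\<in>UNIV. \<Sum>k\<in>UNIV. w i * w k * B i k)" for w
    using contr_square_nonneg(1)[OF p] by simp
  have pd: "0 < (\<Sum>i\<in>UNIV. \<Sum>j\<in>UNIV. w i * w j * gu i j p)" if "\<exists>i\<in>UNIV. w i \<noteq> 0" for w
    using contr_square_nonneg(2)[OF p, of w] that by (simp add: contr_def mult_ac)
  have "0 \<le> contr p B"
    unfolding contr_def
    by (rule sum_mult_nonneg_of_positive_forms[OF finite_class.finite_UNIV gu_commute[OF p] pd psd])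
  then show ?thesis by (simp only: B_def[abs_def])
qed

lemma tensor_norm_square:
  assumes p: "p \<in> cdom c"
  shows "(tensor_norm (g c p) T)\<^sup>2 = contr p (\<lambda>i k. contr p (\<lambda>j l. T $ i $ j * T $ k $ l))"
proof -
  have "(\<Sum>i\<in>UNIV. \<Sum>j\<in>UNIV. \<Sum>k\<in>UNIV. \<Sum>l\<in>UNIV. gu i k p * gu j l p * T $ i $ j * T $ k $ l) =
      (\<Sum>i\<in>UNIV. \<Sum>k\<in>UNIV. \<Sum>j\<in>UNIV. \<Sum>l\<in>UNIV. gu i k p * gu j l p * T $ i $ j * T $ k $ l)"
    by (intro sum.cong refl sum.swap)
  also have "\<dots> = contr p (\<lambda>i k. contr p (\<lambda>j l. T $ i $ j * T $ k $ l))"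
    by (simp add: contr_def sum_distrib_left mult.assoc)
  finally show ?thesis
    using contr_contr_square_nonneg[OF p, of "\<lambda>i j. T $ i $ j"] by (simp add: tensor_norm_def)
qed

lemma contr_gd_left: "p \<in> cdom c \<Longrightarrow> contr p (\<lambda>i j. gd k i p * X j) = X k"
  using contr_gd[of p k X] by (simp add: gd_commute[of p k])

lemma contr_gd_right: "p \<in> cdom c \<Longrightarrow> contr p (\<lambda>i j. X i * gd k j p) = X k"
  using contr_gd_left[of p k X] contr_transpose[of p "\<lambda>i j. gd k i p * X j"] by (simp add: mult.commute)

text \<open>With s = R/n, the cross terms contribute -2 s R and the metric contributes s^2 n,
  together -R^2/n.\<close>

lemma traceless_ricci_norm:
  assumes p: "p \<in> cdom c"
  shows "(tensor_norm (g c p) (traceless_ricci g c p))\<^sup>2 =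
    contr p (\<lambda>i k. contr p (\<lambda>j l. Ric i j p * Ric k l p)) - (scalar_curvature g c p)\<^sup>2 / real CARD('n)"
proof -
  define s where "s = scalar_curvature g c p / real CARD('n)"
  have "contr p (\<lambda>j l. (Ric i j p - s * gd i j p) * (Ric k l p - s * gd k l p)) =
      contr p (\<lambda>j l. Ric i j p * Ric k l p) - 2 * s * Ric i k p + s * s * gd i k p" for i k
  proof -
    have "contr p (\<lambda>j l. (Ric i j p - s * gd i j p) * (Ric k l p - s * gd k l p)) =
        contr p (\<lambda>j l. Ric i j p * Ric k l p - s * (Ric i j p * gd k l p)
          - s * (gd i j p * Ric k l p) + s * s * (gd i j p * gd k l p))"
      by (simp add: algebra_simps)
    then show ?thesis
      by (simp add: contr_linear contr_gd_left[OF p] contr_gd_right[OF p] Ric_commute[OF p, of k i]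
          gd_commute[OF p, of k i])
  qed
  moreover have "traceless_ricci g c p $ i $ j = Ric i j p - s * gd i j p" for i j
    by (simp add: traceless_ricci_def s_def)
  ultimately have "(tensor_norm (g c p) (traceless_ricci g c p))\<^sup>2 =
      contr p (\<lambda>i k. contr p (\<lambda>j l. Ric i j p * Ric k l p)) - 2 * s * scalar_curvature g c p
        + s * s * real CARD('n)"
    by (simp add: tensor_norm_square[OF p] contr_linear
        scalar_curvature_eq contr_gd_gd[OF p])
  then show ?thesis by (simp add: s_def power2_eq_square field_simps)
qed

subsection \<open>Hessian and Laplacian\<close>

abbreviation Hess :: "('a \<Rightarrow> real) \<Rightarrow> 'n \<Rightarrow> 'n \<Rightarrow> 'a \<Rightarrow> real" where
  "Hess u \<equiv> nabla1 (\<lambda>k. D k u)"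

lemma hessian_eq: "hessian g c u p $ i $ j = Hess u i j p"
  by (simp add: hessian_def cov_deriv_form_def differential_def nabla1_def)

lemma smooth_nabla1 [intro]: "(\<And>i. smooth (w i)) \<Longrightarrow> smooth (nabla1 w i j)"
  unfolding nabla1_def[abs_def]
  by (intro smooth_diff smooth_sum smooth_mult smooth_christoffel smooth_D)

lemma Hess_commute:
  "smooth u \<Longrightarrow> p \<in> cdom c \<Longrightarrow> Hess u i j p = Hess u j i p"
  by (simp add: nabla1_def D_commute[of u p i j] christoffel_commute[of p _ i j])

lemma nabla1_cong:
  assumes "p \<in> cdom c" "\<And>i q. q \<in> cdom c \<Longrightarrow> w i q = z i q"
  shows "nabla1 w a i p = nabla1 z a i p"
proof -
  have "D a (w i) p = D a (z i) p" using assms by (rule D_cong)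
  then show ?thesis by (simp add: nabla1_def assms)
qed

lemma nabla1_add:
  "(\<And>i. smooth (w i)) \<Longrightarrow> (\<And>i. smooth (z i)) \<Longrightarrow> p \<in> cdom c \<Longrightarrow>
    nabla1 (\<lambda>i q. w i q + z i q) a i p = nabla1 w a i p + nabla1 z a i p"
  by (simp add: nabla1_def D_add distrib_left sum.distrib)

lemma nabla1_cmult:
  "(\<And>i. smooth (w i)) \<Longrightarrow> p \<in> cdom c \<Longrightarrow> nabla1 (\<lambda>i q. b * w i q) a i p = b * nabla1 w a i p"
  by (simp add: nabla1_def D_cmult right_diff_distrib sum_distrib_left mult_ac)

text \<open>The Leibniz rule for a 1-form contracted with a tensor, meant for Ric(grad u); the
  metric is parallel and leaves no term of its own.\<close>

lemma nabla1_contr: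
  assumes w: "\<And>i. smooth (w i)" and T: "\<And>i j. smooth (T i j)" and p: "p \<in> cdom c"
  shows "nabla1 (\<lambda>k q. contr q (\<lambda>i j. w i q * T j k q)) a k p =
    contr p (\<lambda>i j. nabla1 w a i p * T j k p + w i p * nabla2 T a j k p)"
proof -
  have "D a (\<lambda>q. contr q (\<lambda>i j. w i q * T j k q)) p =
      contr p (\<lambda>i j. nabla1 w a i p * T j k p + w i p * (D a (T j k) p - (\<Sum>r\<in>UNIV. \<Gamma> r a j p * T r k p)))"
    using assms by (simp add: D_contr smooth_mult D_mult nabla1_def algebra_simps sum_distrib_left)
  then show ?thesis
    by (simp add: nabla1_def[of "\<lambda>k q. contr q (\<lambda>i j. w i q * T j k q)"] nabla2_def
        contr_sum[symmetric] contr_mult_left[symmetric] contr_diff[symmetric])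
       (simp add: algebra_simps sum_distrib_left)
qed

text \<open>One Christoffel term from the derivative of the inverse metric cancels the connection
  term of the divergence, the other is the correction in the Hessian.\<close>

lemma laplacian_eq:
  assumes u: "smooth u" and p: "p \<in> cdom c"
  shows "laplacian g c u p = contr p (\<lambda>i j. Hess u i j p)"
proof -
  have grad: "gradient g c u q $ i = (\<Sum>k\<in>UNIV. gu i k q * D k u q)" for i q
    by (simp add: gradient_def differential_def matrix_vector_mult_def)
  have swap: "(\<Sum>k\<in>UNIV. (\<Sum>r\<in>UNIV. X r * Y r k) * Z k) = (\<Sum>r\<in>UNIV. X r * (\<Sum>k\<in>UNIV. Y r k * Z k))"
    for X Y and Z :: "'n \<Rightarrow> real"
    unfolding sum_distrib_left sum_distrib_right by (subst sum.swap) (simp add: mult_ac)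
  have swap': "(\<Sum>k\<in>UNIV. (\<Sum>r\<in>UNIV. Y r k * X r) * Z k) = (\<Sum>r\<in>UNIV. X r * (\<Sum>k\<in>UNIV. Y r k * Z k))"
    for X Y and Z :: "'n \<Rightarrow> real"
    unfolding sum_distrib_left sum_distrib_right by (subst sum.swap) (simp add: mult_ac)
  have "D i (\<lambda>q. gradient g c u q $ i) p + (\<Sum>k\<in>UNIV. \<Gamma> i i k p * gradient g c u p $ k) =
      (\<Sum>k\<in>UNIV. gu i k p * Hess u i k p)" for i
    unfolding grad using p u
    by (simp add: D_sum D_mult smooth_mult smooth_gu smooth_D D_gu nabla1_def sum.distrib
        left_diff_distrib right_diff_distrib sum_subtractf sum_negf swap swap')
  then show ?thesis
    by (simp add: laplacian_def divergence_def trace_def cov_deriv_field_def contr_def)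
qed

lemma ricci_identity:
  assumes u: "smooth u" and p: "p \<in> cdom c"
  shows "nabla2 (Hess u) i j k p - nabla2 (Hess u) j i k p =
    - (\<Sum>l\<in>UNIV. riemann g c l i j k p * D l u p)"
proof -
  have swap: "(\<Sum>r\<in>UNIV. X r * (\<Sum>s\<in>UNIV. Y s r * Z s)) = (\<Sum>s\<in>UNIV. (\<Sum>r\<in>UNIV. Y s r * X r) * Z s)"
    for X Y and Z :: "'n \<Rightarrow> real"
    unfolding sum_distrib_left sum_distrib_right by (subst sum.swap) (simp add: mult_ac)
  have "D i (Hess u j k) p = D i (D j (D k u)) p
      - (\<Sum>r\<in>UNIV. \<Gamma> r j k p * D i (D r u) p) - (\<Sum>r\<in>UNIV. D i (\<Gamma> r j k) p * D r u p)" for i j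
    unfolding nabla1_def[abs_def] using u p
    by (simp add: D_diff D_sum D_mult smooth_D smooth_sum smooth_mult smooth_christoffel sum.distrib)
  \<comment> \<open>Arranged for antisymmetrization in \<open>i\<close> and \<open>j\<close>: the
    two sums with second derivatives of \<open>u\<close> exchange, the \<open>Hess\<close> sum is
    symmetric as the connection is torsion-free, and only curvature terms remain.\<close>
  then have H: "nabla2 (Hess u) i j k p = D i (D j (D k u)) p
      - (\<Sum>r\<in>UNIV. \<Gamma> r j k p * D i (D r u) p) - (\<Sum>r\<in>UNIV. \<Gamma> r i k p * D j (D r u) p)
      - (\<Sum>r\<in>UNIV. D i (\<Gamma> r j k) p * D r u p) - (\<Sum>r\<in>UNIV. \<Gamma> r i j p * Hess u r k p)
      + (\<Sum>s\<in>UNIV. (\<Sum>r\<in>UNIV. \<Gamma> s j r p * \<Gamma> r i k p) * D s u p)" for i j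
    by (simp add: nabla2_def nabla1_def[of _ j] right_diff_distrib sum_subtractf swap)
  have R: "(\<Sum>l\<in>UNIV. riemann g c l i j k p * D l u p) =
      (\<Sum>r\<in>UNIV. D i (\<Gamma> r j k) p * D r u p) - (\<Sum>r\<in>UNIV. D j (\<Gamma> r i k) p * D r u p)
      + (\<Sum>s\<in>UNIV. (\<Sum>r\<in>UNIV. \<Gamma> s i r p * \<Gamma> r j k p) * D s u p)
      - (\<Sum>s\<in>UNIV. (\<Sum>r\<in>UNIV. \<Gamma> s j r p * \<Gamma> r i k p) * D s u p)"
    by (simp add: riemann_def left_diff_distrib distrib_right sum.distrib sum_subtractf)
  show ?thesis
    unfolding H R
    using D_commute[OF smooth_D[OF u] p, of i j k] by (simp add: christoffel_commute[OF p, of _ i j])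
qed

text \<open>Symmetry of the Hessian makes \<open>k\<close> the middle index, the Ricci identity
  moves it to the front, and the trace of the resulting curvature term is Ricci.\<close>

lemma divergence_hessian:
  assumes u: "smooth u" and p: "p \<in> cdom c"
  shows "contr p (\<lambda>i j. nabla2 (Hess u) i j k p) =
    D k (laplacian g c u) p + contr p (\<lambda>i j. D i u p * Ric j k p)"
proof -
  have sH: "smooth (Hess u i j)" for i j using u by (intro smooth_nabla1 smooth_D)
  have swap: "nabla2 (Hess u) i j k p = nabla2 (Hess u) i k j p" for i j
  proof -
    have "nabla2 (Hess u) i j k p = nabla2 (\<lambda>j k. Hess u k j) i j k p"
      using p u by (intro nabla2_cong) (auto simp: Hess_commute)
    then show ?thesis by (simp add: nabla2_def)
  qed
  \<comment> \<open>Exchanging the last two slots puts \<open>i\<close> and \<open>j\<close> into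
    positions 1 and 4, ready to be contracted to Ricci.\<close>
  have R: "(\<Sum>l\<in>UNIV. riemann g c l i k j p * D l u p) = - contr p (\<lambda>l m. D l u p * Rm i k m j p)" for i j
  proof -
    have "(\<Sum>l\<in>UNIV. riemann g c l i k j p * D l u p) = contr p (\<lambda>l m. D l u p * Rm i k j m p)"
      by (simp add: riemann_eq[OF p] contr_def sum_distrib_left sum_distrib_right mult_ac)
    also have "\<dots> = contr p (\<lambda>l m. - (D l u p * Rm i k m j p))"
      by (simp add: Rm_swap_34[OF p, of i k j])
    finally show ?thesis by (simp only: contr_minus)
  qed
  have "nabla2 (Hess u) i j k p =
      nabla2 (Hess u) k i j p + contr p (\<lambda>l m. D l u p * Rm i k m j p)" for i j
    using ricci_identity[OF u p, of i k j] by (simp add: swap R)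
  then have "contr p (\<lambda>i j. nabla2 (Hess u) i j k p) = contr p (\<lambda>i j. nabla2 (Hess u) k i j p)
      + contr p (\<lambda>i j. contr p (\<lambda>l m. D l u p * Rm i k m j p))"
    by (simp add: contr_add)
  also have "contr p (\<lambda>i j. contr p (\<lambda>l m. D l u p * Rm i k m j p)) =
      contr p (\<lambda>l m. contr p (\<lambda>i j. D l u p * Rm i k m j p))"
    by (rule contr_commute)
  also have "\<dots> = contr p (\<lambda>l m. D l u p * Ric m k p)"
    by (simp add: contr_mult_left Ric_eq[OF p, symmetric] Ric_commute[OF p, of k])
  also have "contr p (\<lambda>i j. nabla2 (Hess u) k i j p) = D k (laplacian g c u) p"
    unfolding contr_nabla2[OF sH p] using p u by (intro D_cong) (auto simp: laplacian_eq)
  finally show ?thesis .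
qed

subsection \<open>Quasi-Einstein metrics of constant scalar curvature\<close>

text \<open>For b = -1/m the bracket is exactly the combination of Hess f and df (x) df in the
  quasi-Einstein equation.\<close>

lemma Hess_exp:
  assumes f: "smooth f" and p: "p \<in> cdom c"
  shows "Hess (\<lambda>q. exp (b * f q)) i j p =
    b * exp (b * f p) * (Hess f i j p + b * (D i f p * D j f p))"
proof -
  let ?u = "\<lambda>q. exp (b * f q)"
  have u: "smooth ?u" using f by (intro smooth_exp smooth_mult smooth_const)
  have Du: "D j ?u q = b * (?u q * D j f q)" if "q \<in> cdom c" for j q
    using f that by (simp add: D_exp D_cmult smooth_mult smooth_const)
  have "Hess ?u i j p = nabla1 (\<lambda>j q. b * (?u q * D j f q)) i j p"
    using p Du by (intro nabla1_cong) auto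
  then show ?thesis
    using p f u by (simp add: nabla1_def D_cmult D_mult smooth_mult smooth_D Du right_diff_distrib
        sum_distrib_left algebra_simps)
qed

text \<open>Only the linear equation for \<open>Hess u\<close> enters, not the exponential form of
  \<open>u\<close>. The first summand stems from R times the Laplacian of u, the second from the
  pairing of Ric with Hess u, still with the full norm of Ric.\<close>

lemma laplacian_conformal_factor:
  fixes m R :: real and u lam :: "'a \<Rightarrow> real"
  assumes u: "smooth u" and lam: "smooth lam" and m: "m \<noteq> 0" and p: "p \<in> cdom c"
    and Hess: "\<And>i j q. q \<in> cdom c \<Longrightarrow> Hess u i j q = u q / m * (Ric i j q - lam q * gd i j q)"
    and scal: "\<And>q. q \<in> cdom c \<Longrightarrow> scalar_curvature g c q = R"
  shows "(real CARD('n) - 1) * laplacian g c (\<lambda>q. u q * lam q) p = u p / m *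
    (R * (R - real CARD('n) * lam p)
      + (m - 1) * (contr p (\<lambda>i k. contr p (\<lambda>j l. Ric i j p * Ric k l p)) - R * lam p))"
proof -
  let ?n = "real CARD('n)"
  let ?v = "\<lambda>q. u q * lam q"
  define P where "P k q = contr q (\<lambda>i j. D i u q * Ric j k q)" for k q
  have v: "smooth ?v" using u lam by (rule smooth_mult)
  have sP: "smooth (P k)" for k
    unfolding P_def[abs_def] using u by (intro smooth_contr smooth_mult smooth_D smooth_Ric)
  have div_Ric: "contr q (\<lambda>i j. nabla2 Ric i j k q) = 0" if q: "q \<in> cdom c" for k q
  proof -
    have "D k (scalar_curvature g c) q = D k (\<lambda>q. R) q"
      using q scal by (rule D_cong)
    then show ?thesis using contracted_bianchi[OF q, of k] by simp
  qed
  have lap_u: "laplacian g c u q = 1 / m * (u q * R - ?v q * ?n)" if q: "q \<in> cdom c" for q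
  proof -
    have "laplacian g c u q = u q / m * (contr q (\<lambda>i j. Ric i j q) - lam q * contr q (\<lambda>i j. gd i j q))"
      by (simp only: laplacian_eq[OF u q] Hess[OF q] contr_linear)
    then show ?thesis
      by (simp add: scalar_curvature_eq[symmetric] scal[OF q] contr_gd_gd[OF q] field_simps)
  qed
  \<comment> \<open>Both evaluations of div (Hess u) are compared: directly from the equation for
    \<open>Hess u\<close>, and through \<open>divergence_hessian\<close>.\<close>
  have Dv: "(?n - 1) * D k ?v q = R * D k u q + (m - 1) * P k q" if q: "q \<in> cdom c" for k q
  proof -
    have "nabla2 (Hess u) i j k q =
        1 / m * (D i u q * Ric j k q + u q * nabla2 Ric i j k q - D i ?v q * gd j k q)" for i j
    proof -
      have "nabla2 (Hess u) i j k q =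
          nabla2 (\<lambda>i j q. (1 / m) * (u q * Ric i j q - ?v q * gd i j q)) i j k q"
        using q by (intro nabla2_cong) (auto simp: Hess algebra_simps diff_divide_distrib)
      then show ?thesis
        using q u v by (simp only: nabla2_mult nabla2_diff smooth_const smooth_diff smooth_mult
            smooth_Ric smooth_gd D_const nabla2_gd)
          simp
    qed
    then have "contr q (\<lambda>i j. nabla2 (Hess u) i j k q) =
        1 / m * (P k q + u q * contr q (\<lambda>i j. nabla2 Ric i j k q) - contr q (\<lambda>i j. D i ?v q * gd k j q))"
      by (simp only: contr_linear P_def gd_commute[OF q, of _ k])
    then have "contr q (\<lambda>i j. nabla2 (Hess u) i j k q) = 1 / m * (P k q - D k ?v q)"
      by (simp add: div_Ric[OF q] contr_gd_right[OF q])
    moreover have "D k (laplacian g c u) q = D k (\<lambda>q. 1 / m * (u q * R - ?v q * ?n)) q"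
      using q lap_u by (rule D_cong)
    then have "D k (laplacian g c u) q = 1 / m * (D k u q * R - D k ?v q * ?n)"
      using q u v by (simp only: D_cmult D_diff D_mult D_const smooth_mult smooth_diff smooth_const) simp
    ultimately have "1 / m * (P k q - D k ?v q) = 1 / m * (D k u q * R - D k ?v q * ?n) + P k q"
      using divergence_hessian[OF u q, of k] by (simp add: P_def)
    then show ?thesis using m by (simp add: field_simps)
  qed
  have nabla_P: "contr p (\<lambda>a k. nabla1 P a k p) =
      u p / m * (contr p (\<lambda>i k. contr p (\<lambda>j l. Ric i j p * Ric k l p)) - R * lam p)"
  proof -
    \<comment> \<open>The divergence of \<open>P\<close> contracts the direction \<open>a\<close>
      with the second slot of Ric, whereas \<open>div_Ric\<close> concerns the first.\<close>
    have sym: "nabla2 Ric a j k p = nabla2 Ric a k j p" for a j k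
    proof -
      have "nabla2 Ric a j k p = nabla2 (\<lambda>j k. Ric k j) a j k p"
        using p by (rule nabla2_cong) (rule Ric_commute)
      then show ?thesis by (simp add: nabla2_def)
    qed
    have cross: "contr p (\<lambda>i j. Hess u a i p * Ric j k p) =
        u p / m * (contr p (\<lambda>i j. Ric a i p * Ric k j p) - lam p * Ric a k p)" for a k
    proof -
      have "contr p (\<lambda>i j. Hess u a i p * Ric j k p) =
          contr p (\<lambda>i j. u p / m * (Ric a i p * Ric k j p - lam p * (gd a i p * Ric j k p)))"
        by (simp add: Hess[OF p] Ric_commute[OF p, of _ k] algebra_simps)
      then show ?thesis
        by (simp only: contr_linear contr_gd_left[OF p])
    qed
    have "nabla1 P a k p = contr p (\<lambda>i j. Hess u a i p * Ric j k p + D i u p * nabla2 Ric a k j p)" for a k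
      unfolding P_def[abs_def] using nabla1_contr[OF smooth_D[OF u] smooth_Ric p] by (simp add: sym)
    then have "contr p (\<lambda>a k. nabla1 P a k p) =
        contr p (\<lambda>a k. contr p (\<lambda>i j. Hess u a i p * Ric j k p))
        + contr p (\<lambda>a k. contr p (\<lambda>i j. D i u p * nabla2 Ric a k j p))"
      by (simp only: contr_add)
    also have "contr p (\<lambda>a k. contr p (\<lambda>i j. D i u p * nabla2 Ric a k j p)) =
        contr p (\<lambda>i j. D i u p * contr p (\<lambda>a k. nabla2 Ric a k j p))"
      by (subst contr_commute) (simp only: contr_mult_left)
    also have "\<dots> = 0" by (simp only: div_Ric[OF p]) (simp add: contr_def)
    finally show ?thesis
      by (simp only: cross contr_linear scalar_curvature_eq[symmetric] scal[OF p]) (simp add: mult.commute)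
  qed
  \<comment> \<open>The first-order identity \<open>Dv\<close> holds on the whole chart domain, so
    it may be differentiated covariantly and then traced.\<close>
  have "(?n - 1) * Hess ?v a k p = R * Hess u a k p + (m - 1) * nabla1 P a k p" for a k
  proof -
    have "(?n - 1) * Hess ?v a k p = nabla1 (\<lambda>k q. (?n - 1) * D k ?v q) a k p"
      using p v by (simp add: nabla1_cmult smooth_D)
    also have "\<dots> = nabla1 (\<lambda>k q. R * D k u q + (m - 1) * P k q) a k p"
      using p Dv by (rule nabla1_cong)
    also have "\<dots> = R * Hess u a k p + (m - 1) * nabla1 P a k p"
      using p u sP by (simp add: nabla1_add nabla1_cmult smooth_D smooth_mult smooth_const)
    finally show ?thesis .
  qed
  then have "contr p (\<lambda>a k. (?n - 1) * Hess ?v a k p) =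
      contr p (\<lambda>a k. R * Hess u a k p + (m - 1) * nabla1 P a k p)"
    by simp
  then have "(?n - 1) * laplacian g c ?v p = R * laplacian g c u p + (m - 1) * contr p (\<lambda>a k. nabla1 P a k p)"
    by (simp only: contr_linear laplacian_eq[OF v p] laplacian_eq[OF u p])
  moreover have "laplacian g c u p = u p / m * (R - ?n * lam p)"
    unfolding lap_u[OF p] by (simp add: algebra_simps diff_divide_distrib)
  moreover have "R * (k * a) + (m - 1) * (k * b) = k * (R * a + (m - 1) * b)" for k a b :: real
    by algebra
  ultimately show ?thesis by (simp only: nabla_P)
qed

end

section \<open>Final algebra and the theorem\<close>

lemma quasi_einstein_arithmetic:
  fixes m N R T l :: real
  assumes "m > 0" "N > 0"
  shows "(R * (R - N * l) + (m - 1) * (T + R\<^sup>2 / N - R * l)) / m =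
    (m - 1) / m * T - R * (N * l - R) / N * (1 + (N - 1) / m)"
proof -
  \<comment> \<open>Writing R = N x removes the denominator N; after multiplication by
    \<open>m\<close> a polynomial identity remains.\<close>
  define x where "x = R / N"
  have *: "R\<^sup>2 / N = R * x" "R * (N * l - R) / N = R * (l - x)" "R = N * x"
    using assms by (simp_all add: x_def power2_eq_square field_simps)
  have "R * (R - N * l) + (m - 1) * (T + R * x - R * l) =
      m * ((m - 1) / m * T - R * (l - x) * (1 + (N - 1) / m))"
    unfolding *(3) using assms
    by (simp add: distrib_left right_diff_distrib[of m]) (simp add: algebra_simps)
  then show ?thesis
    unfolding *(1,2) using assms by (simp only: nonzero_mult_div_cancel_left)
qed

theorem lemma4p1:
  fixes M :: "'a topology"
    and \<A> :: "('a, 'n::finite) chart set"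
    and g :: "('a, 'n) tensor2"
    and f lam v :: "'a \<Rightarrow> real"
    and m R :: real
    and n :: nat
  assumes n: "n = CARD('n)" and n_ge: "n \<ge> 3"
    and m: "m > 0"
    and mfd: "riemannian_manifold M \<A> g"
    and conn: "connected_space M"
    and noncompact: "\<not> compact_space M"
    and complete: "geodesically_complete M \<A> g"
    and smooth_f: "smooth_function \<A> f"
    and smooth_lambda: "smooth_function \<A> lam"
    and quasi_einstein: "\<And>c p. c \<in> \<A> \<Longrightarrow> p \<in> cdom c \<Longrightarrow>
      ricci g c p + hessian g c f p
        - (1 / m) *\<^sub>R tensor_prod (differential c f p) (differential c f p) = lam p *\<^sub>R g c p"
    and const_scalar: "\<And>c p. c \<in> \<A> \<Longrightarrow> p \<in> cdom c \<Longrightarrow> scalar_curvature g c p = R"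
    and v: "v = (\<lambda>p. exp (- f p / m) * lam p)"
  shows "\<forall>c\<in>\<A>. \<forall>p\<in>cdom c.
    exp (f p / m) * laplacian g c v p =
      1 / (real n - 1) * ((m - 1) / m * (tensor_norm (g c p) (traceless_ricci g c p))\<^sup>2
        - R * (real n * lam p - R) / real n * (1 + (real n - 1) / m))"
proof (intro ballI)
  fix c p
  assume c: "c \<in> \<A>" and p: "p \<in> cdom c"
  interpret riemannian_chart M \<A> g c
    using mfd c
    by (simp add: riemannian_chart_def manifold_chart_def manifold_chart_axioms_def riemannian_manifold_def)
  have f: "smooth f" and lam: "smooth lam"
    using smooth_f smooth_lambda c by (simp_all add: smooth_function_def)
  define u where "u q = exp ((- 1 / m) * f q)" for q
  have u: "smooth u"
    unfolding u_def[abs_def] using f by (intro smooth_exp smooth_mult smooth_const)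
  have Hess_u: "Hess u i j q = u q / m * (Ric i j q - lam q * gd i j q)" if q: "q \<in> cdom c" for i j q
  proof -
    have "Ric i j q + Hess f i j q - 1 / m * (D i f q * D j f q) = lam q * gd i j q"
      using arg_cong[OF quasi_einstein[OF c q], of "\<lambda>A. A $ i $ j"]
      by (simp add: hessian_eq tensor_prod_def differential_def)
    \<comment> \<open>The right side is the negative of the bracket in \<open>Hess_exp\<close> for b
      = -1/m; the two signs cancel.\<close>
    then have "Ric i j q - lam q * gd i j q = - (Hess f i j q + (- 1 / m) * (D i f q * D j f q))"
      by simp
    moreover have "(- 1 / m) * b * d = b / m * - d" for b d :: real by simp
    ultimately show ?thesis
      unfolding u_def[abs_def] Hess_exp[OF f q] by (simp only:)
  qed
  let ?L = "laplacian g c v p"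
  let ?T = "(tensor_norm (g c p) (traceless_ricci g c p))\<^sup>2"
  have veq: "v = (\<lambda>q. u q * lam q)" by (simp add: v u_def)
  have n0: "real n - 1 > 0" using n_ge by simp
  \<comment> \<open>The squared norm of Ric is expressed as \<open>?T + R\<^sup>2 / real n\<close>,
    which introduces the trace-free part.\<close>
  have "(real n - 1) * ?L = u p / m * (R * (R - real n * lam p) + (m - 1) * (?T + R\<^sup>2 / real n - R * lam p))"
    unfolding veq n traceless_ricci_norm[OF p] const_scalar[OF c p]
    using laplacian_conformal_factor[OF u lam _ p Hess_u const_scalar[OF c]] m by simp
  then have "exp (f p / m) * ((real n - 1) * ?L) = (exp (f p / m) * u p) *
      ((R * (R - real n * lam p) + (m - 1) * (?T + R\<^sup>2 / real n - R * lam p)) / m)"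
    by simp
  also have "exp (f p / m) * u p = 1"
    by (simp add: u_def exp_minus)
  finally have "(real n - 1) * (exp (f p / m) * ?L) =
      (R * (R - real n * lam p) + (m - 1) * (?T + R\<^sup>2 / real n - R * lam p)) / m"
    by (simp only: mult.left_commute mult_1_left)
  also have "\<dots> = (m - 1) / m * ?T - R * (real n * lam p - R) / real n * (1 + (real n - 1) / m)"
    using m n0 by (intro quasi_einstein_arithmetic) simp_all
  finally have result: "(real n - 1) * (exp (f p / m) * ?L) =
      (m - 1) / m * ?T - R * (real n * lam p - R) / real n * (1 + (real n - 1) / m)" .
  have "a = 1 / b * d" if "b * a = d" "b > 0" for a b d :: real
    using that by auto
  from this[OF result n0] show "exp (f p / m) * ?L = 1 / (real n - 1) * ((m - 1) / m * ?T
      - R * (real n * lam p - R) / real n * (1 + (real n - 1) / m))" .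
qed

end
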